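(* Let $r\ge2$ be an integer, and let $F$ be a finite $r$-graph with $e(F)>0$ ($F$ may have isolated vertices). An $r$-graph $H$ is $F$-abundant if and only if there is an $F$-colouring $\sigma$ of $H$ such that the $F$-coloured $r$-graph $(H,\sigma)$ is $F$-abundant.
   Context: An $r$-graph is a finite simple $r$-uniform hypergraph $H$ with vertex set $V(H)$ and edge set $E(H)$; $v(H)=|V(H)|$, $e(H)=|E(H)|$. A homomorphism $H\to G$ is a map $\phi:V(H)\to V(G)$ with $\phi(e)\in E(G)$ for every $e\in E(H)$; an embedding is an injective homomorphism. $\mathrm{Emb}(H,G)$ is the number of embeddings of $H$ into $G$. Copies are not required to be induced; $G$ is $F$-free if there is no embedding of $F$ into $G$. An $n$-vertex $r$-graph $G$ is $\varepsilon$-far from being $F$-free if at least $\varepsilon n^r$ edges must be deleted from $G$ to make it $F$-free. An $F$-colouring of an $r$-graph $G$ is a homomorphism $\kappa_G:G\to F$; the sets $V_a(G)=\kappa_G^{-1}(a)$, $a\in V(F)$, form an $F$-partition of $G$, and an $r$-graph with such a (fixed) partition is called $F$-partite. An $F$-coloured $r$-graph is a pair $(H,\sigma)$ with $\sigma:H\to F$ an $F$-colouring. For $G$ $F$-partite, $\mathrm{Emb}_\sigma(H,G)$ is the number of embeddings $\phi:H\to G$ with $\kappa_G\circ\phi=\sigma$. An $n$-vertex $F$-partite $r$-graph $G$ is uniformly $\varepsilon$-far from being $F$-free if there is a collection $\mathcal C$ of embeddings $\psi:F\to G$ such that the sets $\psi(E(F))$, $\psi\in\mathcal C$, are pairwise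 disjoint, $\kappa_G\circ\psi=\mathrm{id}_{V(F)}$ for every $\psi\in\mathcal C$, and every vertex of $G$ belongs to $\psi(V(F))$ for at least $\varepsilon n^{r-1}$ members $\psi\in\mathcal C$. An $r$-graph $H$ is $F$-abundant if there are constants $c,C>0$ such that, for every $0<\varepsilon\le1$, there is $n_0(\varepsilon)$ for which every $\varepsilon$-far $n$-vertex $r$-graph $G$ with $n\ge n_0(\varepsilon)$ satisfies $\mathrm{Emb}(H,G)\ge c\varepsilon^C n^{v(H)}$. An $F$-coloured $r$-graph $(H,\sigma)$ is $F$-abundant if there are constants $c,C>0$ such that, for every $0<\varepsilon\le1$, there is $n_0(\varepsilon)$ for which every uniformly $\varepsilon$-far $n$-vertex $F$-partite $r$-graph $G$ with $n\ge n_0(\varepsilon)$ satisfies $\mathrm{Emb}_\sigma(H,G)\ge c\varepsilon^C n^{v(H)}$. *)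

theory Defs
  imports "HOL-Analysis.Analysis"
begin

record 'a hypergraph =
  verts :: "'a set"
  edges :: "'a set set"

definition r_graph :: "nat \<Rightarrow> 'a hypergraph \<Rightarrow> bool" where
  "r_graph r G \<longleftrightarrow> finite (verts G) \<and> (\<forall>e\<in>edges G. e \<subseteq> verts G \<and> card e = r)"

text \<open>
  Maps between vertex sets are extensional (\<open>undefined\<close> outside the domain), so that each map
  is represented by exactly one HOL function and counting maps is meaningful.
\<close>

definition homs :: "'a hypergraph \<Rightarrow> 'b hypergraph \<Rightarrow> ('a \<Rightarrow> 'b) set" where
  "homs H G = {\<phi> \<in> verts H \<rightarrow>\<^sub>E verts G. \<forall>e\<in>edges H. \<phi> ` e \<in> edges G}"

definition embs :: "'a hypergraph \<Rightarrow> 'b hypergraph \<Rightarrow> ('a \<Rightarrow> 'b) set" where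
  "embs H G = {\<phi> \<in> homs H G. inj_on \<phi> (verts H)}"

definition Emb :: "'a hypergraph \<Rightarrow> 'b hypergraph \<Rightarrow> nat" where
  "Emb H G = card (embs H G)"

definition free_of :: "'a hypergraph \<Rightarrow> 'b hypergraph \<Rightarrow> bool" where
  "free_of F G \<longleftrightarrow> embs F G = {}"

definition delete_edges :: "'a hypergraph \<Rightarrow> 'a set set \<Rightarrow> 'a hypergraph" where
  "delete_edges G D = G\<lparr>edges := edges G - D\<rparr>"

definition far_from_free :: "nat \<Rightarrow> real \<Rightarrow> 'a hypergraph \<Rightarrow> 'b hypergraph \<Rightarrow> bool" where
  "far_from_free r \<epsilon> F G \<longleftrightarrow>
     (\<forall>D \<subseteq> edges G. free_of F (delete_edges G D) \<longrightarrow>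
        real (card D) \<ge> \<epsilon> * real (card (verts G)) ^ r)"

definition Emb_col ::
  "'b hypergraph \<Rightarrow> ('b \<Rightarrow> 'a) \<Rightarrow> 'c hypergraph \<Rightarrow> ('c \<Rightarrow> 'a) \<Rightarrow> nat" where
  "Emb_col H \<sigma> G \<kappa> = card {\<phi> \<in> embs H G. \<forall>v\<in>verts H. \<kappa> (\<phi> v) = \<sigma> v}"

text \<open>
  Below, an \<open>F\<close>-partite hypergraph is a hypergraph \<open>G\<close> together with a colouring
  \<open>\<kappa> \<in> homs G F\<close>. The edge sets of distinct members of \<open>\<C>\<close> have to be disjoint; in particular two
  members that differ only at isolated vertices of \<open>F\<close> are not allowed.
\<close>

definition uniformly_far_from_free ::
  "nat \<Rightarrow> real \<Rightarrow> 'a hypergraph \<Rightarrow> 'b hypergraph \<Rightarrow> ('b \<Rightarrow> 'a) \<Rightarrow> bool" where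
  "uniformly_far_from_free r \<epsilon> F G \<kappa> \<longleftrightarrow>
     (\<exists>\<C> \<subseteq> embs F G.
        disjoint_family_on (\<lambda>\<psi>. (`) \<psi> ` edges F) \<C> \<and>
        (\<forall>\<psi>\<in>\<C>. \<forall>a\<in>verts F. \<kappa> (\<psi> a) = a) \<and>
        (\<forall>v\<in>verts G. real (card {\<psi> \<in> \<C>. v \<in> \<psi> ` verts F})
            \<ge> \<epsilon> * real (card (verts G)) ^ (r - 1)))"

text \<open>
  Host graphs live on finite sets of natural numbers. This is no restriction, since every finite
  hypergraph is isomorphic to such a one and all the notions above are isomorphism invariant.
\<close>

definition abundant :: "nat \<Rightarrow> 'a hypergraph \<Rightarrow> 'b hypergraph \<Rightarrow> bool" where
  "abundant r F H \<longleftrightarrow>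
     (\<exists>c C :: real. c > 0 \<and> C > 0 \<and>
       (\<forall>\<epsilon>. 0 < \<epsilon> \<and> \<epsilon> \<le> 1 \<longrightarrow>
         (\<exists>n\<^sub>0. \<forall>G :: nat hypergraph.
            r_graph r G \<and> card (verts G) \<ge> n\<^sub>0 \<and> far_from_free r \<epsilon> F G \<longrightarrow>
            real (Emb H G) \<ge> c * \<epsilon> powr C * real (card (verts G)) ^ card (verts H))))"

definition abundant_col ::
  "nat \<Rightarrow> 'a hypergraph \<Rightarrow> 'b hypergraph \<Rightarrow> ('b \<Rightarrow> 'a) \<Rightarrow> bool" where
  "abundant_col r F H \<sigma> \<longleftrightarrow>
     (\<exists>c C :: real. c > 0 \<and> C > 0 \<and>
       (\<forall>\<epsilon>. 0 < \<epsilon> \<and> \<epsilon> \<le> 1 \<longrightarrow>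
         (\<exists>n\<^sub>0. \<forall>(G :: nat hypergraph) \<kappa>.
            r_graph r G \<and> \<kappa> \<in> homs G F \<and> card (verts G) \<ge> n\<^sub>0 \<and>
            uniformly_far_from_free r \<epsilon> F G \<kappa> \<longrightarrow>
            real (Emb_col H \<sigma> G \<kappa>) \<ge> c * \<epsilon> powr C * real (card (verts G)) ^ card (verts H))))"

end

theory Submission
  imports Defs
begin

text \<open>
  Suppose first that \<open>(H, \<sigma>)\<close> is abundant, and let \<open>G\<close> be \<open>\<epsilon>\<close>-far from being \<open>F\<close>-free. Deleting all
  edges of a maximal edge-disjoint family of copies of \<open>F\<close> makes \<open>G\<close> free of \<open>F\<close>, so such a family
  has at least \<open>\<epsilon>n\<^sup>r / e(F)\<close> members (\<open>far_imp_packing\<close>). A random map \<open>\<kappa> : V(G) \<rightarrow> V(F)\<close> inverts a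
  constant fraction of them (\<open>exists_colouring\<close>), and discarding vertices that lie in few of the
  remaining copies leaves a subgraph on \<open>\<Omega>(\<epsilon>n)\<close> vertices that is uniformly \<open>\<Omega>(\<epsilon>)\<close>-far (\<open>exists_dense_core\<close>, \<open>far_imp_uniformly_far_subgraph\<close>).
  Its \<open>\<sigma>\<close>-coloured copies of \<open>H\<close> are copies of \<open>H\<close> in \<open>G\<close>.

  Conversely, suppose that no colouring of \<open>H\<close> is abundant. Then each \<open>\<sigma>\<close> has arbitrarily large
  \<open>F\<close>-partite hosts \<open>G\<^sub>\<sigma>\<close> with many edge-disjoint copies of \<open>F\<close>, a density \<open>x\<^sub>\<sigma>\<close> say, but with a
  density of at most \<open>b x\<^sub>\<sigma>\<^bsup>2B\<^esup>\<close> of \<open>\<sigma>\<close>-coloured homomorphisms from \<open>H\<close>, where \<open>B\<close> may be as large and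
  \<open>b > 0\<close> as small as desired (\<open>not_abundant_col_imp_sparse_hosts\<close>). The fibre product of hosts over
  \<open>F\<close> multiplies both densities (\<open>has_sparse_hosts_mult\<close>). Its powers bring all \<open>x\<^sub>\<sigma>\<close> into a common
  window \<open>[\<delta>, \<delta>\<^bsup>1/2\<^esup>]\<close> (\<open>exists_balancing_exponent\<close>). The product over all of the \<open>m\<close> colourings
  \<open>\<sigma>\<close> is then a single host that is \<open>\<delta>\<^sup>m\<close>-far from being \<open>F\<close>-free and in which every colouring has
  density at most \<open>b \<delta>\<^sup>B\<close>. Every copy of \<open>H\<close> in an \<open>F\<close>-partite graph has
  some colouring, so \<open>H\<close> itself is too rare there to be abundant. This needs at least one colouring
  of \<open>H\<close> to start from; if there is none, the complete blow-ups of \<open>F\<close> are far from being \<open>F\<close>-free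
  and contain no copy of \<open>H\<close> at all (\<open>abundant_imp_colourable\<close>).
\<close>

section \<open>Edge-disjoint packings\<close>

definition packing :: "'a hypergraph \<Rightarrow> 'b hypergraph \<Rightarrow> ('a \<Rightarrow> 'b) set \<Rightarrow> bool" where
  "packing F G \<C> \<longleftrightarrow> \<C> \<subseteq> embs F G \<and> disjoint_family_on (\<lambda>\<psi>. (`) \<psi> ` edges F) \<C>"

lemma finite_edges: "r_graph r G \<Longrightarrow> finite (edges G)"
  unfolding r_graph_def by (rule finite_subset[of _ "Pow (verts G)"]) auto

lemma finite_homs: "finite (verts H) \<Longrightarrow> finite (verts G) \<Longrightarrow> finite (homs H G)"
  unfolding homs_def by (rule finite_subset[of _ "verts H \<rightarrow>\<^sub>E verts G"]) (auto intro: finite_PiE)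

lemma finite_embs: "finite (verts H) \<Longrightarrow> finite (verts G) \<Longrightarrow> finite (embs H G)"
  by (rule finite_subset[of _ "homs H G"]) (auto simp: embs_def intro: finite_homs)

lemma uniformity_le_card_verts:
  assumes "r_graph r F" "edges F \<noteq> {}"
  shows "card (verts F) \<ge> r"
proof -
  obtain e where "e \<in> edges F" using assms by blast
  then show ?thesis using assms card_mono[of "verts F" e] unfolding r_graph_def by auto
qed

lemma packing_eqI:
  assumes "packing F G \<C>" "\<psi> \<in> \<C>" "\<psi>' \<in> \<C>" "e \<in> edges F" "e' \<in> edges F" "\<psi> ` e = \<psi>' ` e'"
  shows "\<psi> = \<psi>'"
proof (rule ccontr)
  assume "\<psi> \<noteq> \<psi>'"
  then have "((`) \<psi> ` edges F) \<inter> ((`) \<psi>' ` edges F) = {}"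
    using assms unfolding packing_def disjoint_family_on_def by blast
  moreover have "\<psi> ` e \<in> (`) \<psi> ` edges F" using assms(4) by (rule imageI)
  moreover have "\<psi> ` e \<in> (`) \<psi>' ` edges F" unfolding assms(6) using assms(5) by (rule imageI)
  ultimately show False by blast
qed

text \<open>
  A member of a packing is determined by its restriction to any one edge of \<open>F\<close>. Lower bounds on
  the size of a packing thereby become lower bounds on the number of vertices.
\<close>

lemma card_packing_le:
  assumes F: "r_graph r F" "edges F \<noteq> {}" and V: "finite (verts G)" and P: "packing F G \<C>"
  shows "card \<C> \<le> card (verts G) ^ r"
proof -
  obtain e where e: "e \<in> edges F" using F by blast
  have e': "e \<subseteq> verts F" "card e = r" "finite e"
    using F(1) e finite_subset unfolding r_graph_def by blast+
  have "inj_on (\<lambda>\<psi>. restrict \<psi> e) \<C>"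
  proof (rule inj_onI)
    fix \<psi> \<psi>' assume *: "\<psi> \<in> \<C>" "\<psi>' \<in> \<C>" "restrict \<psi> e = restrict \<psi>' e"
    have "\<psi> ` e = \<psi>' ` e"
      using *(3) by (metis image_restrict_eq)
    then show "\<psi> = \<psi>'" using packing_eqI[OF P *(1,2) e e] by simp
  qed
  moreover have "(\<lambda>\<psi>. restrict \<psi> e) ` \<C> \<subseteq> e \<rightarrow>\<^sub>E verts G"
  proof -
    have "\<C> \<subseteq> verts F \<rightarrow>\<^sub>E verts G" using P unfolding packing_def embs_def homs_def by auto
    then have "\<psi> \<in> verts F \<rightarrow>\<^sub>E verts G" if "\<psi> \<in> \<C>" for \<psi> using that by (rule subsetD)
    then show ?thesis using e'(1) by (fastforce simp: PiE_iff)
  qed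
  ultimately have "card \<C> \<le> card (e \<rightarrow>\<^sub>E verts G)"
    by (rule card_inj_on_le) (use V e' in \<open>auto intro: finite_PiE\<close>)
  then show ?thesis using e' by (simp add: card_PiE)
qed

text \<open>Each member of the packing has to lose an edge, and these edges are distinct.\<close>

lemma card_packing_le_card_deletion:
  assumes P: "packing F G \<C>" and D: "finite D" "free_of F (delete_edges G D)"
  shows "card \<C> \<le> card D"
proof -
  have "\<exists>e\<in>edges F. \<psi> ` e \<in> D" if "\<psi> \<in> \<C>" for \<psi>
  proof (rule ccontr)
    assume "\<not> ?thesis"
    moreover have "\<psi> \<in> embs F G" using P that unfolding packing_def by auto
    ultimately have "\<psi> \<in> embs F (delete_edges G D)"
      unfolding embs_def homs_def delete_edges_def by auto
    then show False using D unfolding free_of_def by auto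
  qed
  then obtain g where g: "\<And>\<psi>. \<psi> \<in> \<C> \<Longrightarrow> g \<psi> \<in> edges F \<and> \<psi> ` g \<psi> \<in> D" by metis
  have "inj_on (\<lambda>\<psi>. \<psi> ` g \<psi>) \<C>"
    using g packing_eqI[OF P] by (meson inj_onI)
  then show ?thesis by (rule card_inj_on_le) (use g D in auto)
qed

text \<open>
  The edges of a maximal packing meet every copy of \<open>F\<close>, so that deleting them leaves no copy.
\<close>

lemma far_imp_packing:
  assumes F: "r_graph r F" "edges F \<noteq> {}" and G: "r_graph r G" and far: "far_from_free r \<epsilon> F G"
  shows "\<exists>\<C>. packing F G \<C> \<and> \<epsilon> * real (card (verts G)) ^ r \<le> real (card (edges F) * card \<C>)"
proof -
  have fin: "finite (embs F G)" using F(1) G by (auto simp: r_graph_def intro!: finite_embs)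
  have "finite {\<C>. packing F G \<C>}"
    by (rule finite_subset[of _ "Pow (embs F G)"]) (use fin in \<open>auto simp: packing_def\<close>)
  moreover have "{\<C>. packing F G \<C>} \<noteq> {}"
  proof -
    have "packing F G {}" by (simp add: packing_def disjoint_family_on_def)
    then show ?thesis by blast
  qed
  ultimately have "\<exists>\<C>\<in>{\<C>. packing F G \<C>}. \<forall>\<B>\<in>{\<C>. packing F G \<C>}. \<C> \<subseteq> \<B> \<longrightarrow> \<C> = \<B>"
    by (rule finite_has_maximal)
  then obtain \<C> where P: "packing F G \<C>"
    and max: "\<And>\<B>. packing F G \<B> \<Longrightarrow> \<C> \<subseteq> \<B> \<Longrightarrow> \<C> = \<B>"
    by auto
  define D where "D = (\<Union>\<psi>\<in>\<C>. (`) \<psi> ` edges F)"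
  have CG: "\<C> \<subseteq> embs F G" using P by (simp add: packing_def)
  have finC: "finite \<C>" using CG fin finite_subset by blast
  have DG: "D \<subseteq> edges G" using CG unfolding D_def embs_def homs_def by auto
  have "free_of F (delete_edges G D)"
    unfolding free_of_def
  proof (rule ccontr)
    assume "embs F (delete_edges G D) \<noteq> {}"
    then obtain \<psi> where psi: "\<psi> \<in> embs F (delete_edges G D)" by blast
    have a: "\<psi> \<in> embs F G" and b: "\<And>e. e \<in> edges F \<Longrightarrow> \<psi> ` e \<notin> D"
      using psi unfolding embs_def homs_def delete_edges_def by auto
    have d: "((`) \<psi> ` edges F) \<inter> ((`) \<psi>' ` edges F) = {}" if "\<psi>' \<in> \<C>" for \<psi>'
      using b that unfolding D_def by auto
    have "packing F G (insert \<psi> \<C>)"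
      using P a d unfolding packing_def disjoint_family_on_def by (metis Int_commute insert_iff insert_subset)
    then have "\<psi> \<in> \<C>" using max by blast
    then show False using b F unfolding D_def by blast
  qed
  then have "\<epsilon> * real (card (verts G)) ^ r \<le> real (card D)"
    using far DG unfolding far_from_free_def by blast
  moreover have "card D \<le> card (edges F) * card \<C>"
  proof -
    have "card D \<le> (\<Sum>\<psi>\<in>\<C>. card ((`) \<psi> ` edges F))"
      unfolding D_def by (rule card_UN_le[OF finC])
    also have "\<dots> \<le> (\<Sum>\<psi>\<in>\<C>. card (edges F))"
      by (rule sum_mono) (rule card_image_le[OF finite_edges[OF F(1)]])
    finally show ?thesis by (simp add: mult.commute)
  qed
  ultimately have "\<epsilon> * real (card (verts G)) ^ r \<le> real (card (edges F) * card \<C>)"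
    by (meson of_nat_le_iff order_trans)
  then show ?thesis using P by (intro exI[of _ \<C>] conjI)
qed

section \<open>From an abundant colouring to abundance\<close>

text \<open>
  A uniformly random \<open>\<kappa> : V \<rightarrow> W\<close> inverts a given injection \<open>\<psi>\<close> with probability \<open>|W|\<^bsup>-|W|\<^esup>\<close>, so some
  \<open>\<kappa>\<close> inverts at least the expected number of members of \<open>\<C>\<close>. The probability bound is the
  injectivity of the map that splits \<open>\<kappa>\<close> into \<open>\<kappa> \<circ> \<psi>\<close> and the modification of \<open>\<kappa>\<close> that inverts \<open>\<psi>\<close>.
\<close>

lemma exists_colouring:
  assumes V: "finite V" and W: "finite W" "W \<noteq> {}" and C: "finite \<C>"
    and \<psi>: "\<And>\<psi>. \<psi> \<in> \<C> \<Longrightarrow> inj_on \<psi> W \<and> \<psi> ` W \<subseteq> V"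
  shows "\<exists>\<kappa>\<in>V \<rightarrow>\<^sub>E W. card \<C> \<le> card W ^ card W * card {\<psi>\<in>\<C>. \<forall>a\<in>W. \<kappa> (\<psi> a) = a}"
proof (rule ccontr)
  assume neg: "\<not> ?thesis"
  define K where "K = V \<rightarrow>\<^sub>E W"
  define A where "A \<psi> = {\<kappa>\<in>K. \<forall>a\<in>W. \<kappa> (\<psi> a) = a}" for \<psi>
  define w where "w = card W ^ card W"
  have K: "finite K" "K \<noteq> {}" using V W by (auto simp: K_def intro: finite_PiE simp: PiE_eq_empty_iff)
  have low: "card K \<le> w * card (A \<psi>)" if "\<psi> \<in> \<C>" for \<psi>
  proof -
    have inj: "inj_on \<psi> W" and im: "\<psi> ` W \<subseteq> V" using \<psi>[OF that] by auto
    define m where "m \<kappa> = (\<lambda>x\<in>V. if x \<in> \<psi> ` W then inv_into W \<psi> x else \<kappa> x)" for \<kappa>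
    have m: "m \<kappa> \<in> A \<psi>" if "\<kappa> \<in> K" for \<kappa>
      using that inj im unfolding A_def m_def K_def
      by (auto simp: PiE_iff image_subset_iff)
    have "inj_on (\<lambda>\<kappa>. (\<lambda>a\<in>W. \<kappa> (\<psi> a), m \<kappa>)) K"
    proof (rule inj_onI)
      fix \<kappa> \<kappa>' assume *: "\<kappa> \<in> K" "\<kappa>' \<in> K"
        "(\<lambda>a\<in>W. \<kappa> (\<psi> a), m \<kappa>) = (\<lambda>a\<in>W. \<kappa>' (\<psi> a), m \<kappa>')"
      show "\<kappa> = \<kappa>'"
      proof (rule PiE_ext[of _ V "\<lambda>_. W" _ ])
        show "\<kappa> \<in> V \<rightarrow>\<^sub>E W" "\<kappa>' \<in> V \<rightarrow>\<^sub>E W" using * K_def by auto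
        fix x assume x: "x \<in> V"
        show "\<kappa> x = \<kappa>' x"
        proof (cases "x \<in> \<psi> ` W")
          case True
          then obtain a where "a \<in> W" "x = \<psi> a" by blast
          then show ?thesis using *(3) by (metis (no_types, lifting) Pair_inject restrict_apply')
        next
          case False
          have "m \<kappa> x = m \<kappa>' x" using *(3) by simp
          then show ?thesis using False x by (simp add: m_def)
        qed
      qed
    qed
    moreover have "(\<lambda>\<kappa>. (\<lambda>a\<in>W. \<kappa> (\<psi> a), m \<kappa>)) ` K \<subseteq> (W \<rightarrow>\<^sub>E W) \<times> A \<psi>"
      using m im by (auto simp: K_def PiE_iff)
    ultimately have "card K \<le> card ((W \<rightarrow>\<^sub>E W) \<times> A \<psi>)"
      by (rule card_inj_on_le) (use W K in \<open>auto simp: A_def intro: finite_PiE\<close>)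
    then show ?thesis using W by (simp add: card_cartesian_product card_PiE w_def)
  qed
  have "card \<C> * card K \<le> (\<Sum>\<psi>\<in>\<C>. w * card (A \<psi>))"
    using sum_mono[of \<C> "\<lambda>_. card K", OF low] by simp
  also have "\<dots> = w * (\<Sum>\<psi>\<in>\<C>. card (A \<psi>))" by (simp add: sum_distrib_left)
  also have "(\<Sum>\<psi>\<in>\<C>. card (A \<psi>)) = (\<Sum>\<kappa>\<in>K. card {\<psi>\<in>\<C>. \<forall>a\<in>W. \<kappa> (\<psi> a) = a})"
    by (rule sum_multicount_gen[symmetric]) (use K C in \<open>auto simp: A_def\<close>)
  also have "w * \<dots> = (\<Sum>\<kappa>\<in>K. w * card {\<psi>\<in>\<C>. \<forall>a\<in>W. \<kappa> (\<psi> a) = a})"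
    by (simp add: sum_distrib_left)
  also have "\<dots> < (\<Sum>\<kappa>\<in>K. card \<C>)"
    by (rule sum_strict_mono) (use K neg in \<open>auto simp: K_def w_def not_le\<close>)
  finally show False by (simp add: mult.commute)
qed

text \<open>
  Instead of removing vertices of degree below \<open>d\<close> one at a time, take \<open>U\<close> to maximise the number of
  members inside \<open>U\<close> minus \<open>d |U|\<close>: a vertex of \<open>U\<close> of degree below \<open>d\<close> could be dropped to increase
  this quantity.
\<close>

lemma exists_dense_core:
  fixes S :: "'c \<Rightarrow> 'b set" and d :: real
  assumes V: "finite V" and C: "finite \<C>" and S: "\<And>c. c \<in> \<C> \<Longrightarrow> S c \<subseteq> V" and d: "d \<ge> 0"
  shows "\<exists>U\<subseteq>V. real (card \<C>) - d * real (card V) \<le> real (card {c\<in>\<C>. S c \<subseteq> U}) \<and>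
           (\<forall>u\<in>U. d \<le> real (card {c\<in>\<C>. S c \<subseteq> U \<and> u \<in> S c}))"
proof -
  define f where "f U = real (card {c\<in>\<C>. S c \<subseteq> U}) - d * real (card U)" for U
  have "Max (f ` Pow V) \<in> f ` Pow V" by (rule Max_in) (use V in auto)
  then obtain U where U: "U \<subseteq> V" and fU: "f U = Max (f ` Pow V)" by auto
  have max: "f T \<le> f U" if "T \<subseteq> V" for T
    unfolding fU by (rule Max_ge) (use V that in auto)
  have finU: "finite U" using U V finite_subset by blast
  have "{c\<in>\<C>. S c \<subseteq> V} = \<C>" using S by auto
  then have "real (card \<C>) - d * real (card V) \<le> f U" using max[of V] by (simp add: f_def)
  also have "\<dots> \<le> real (card {c\<in>\<C>. S c \<subseteq> U})" using d by (simp add: f_def)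
  finally have 1: "real (card \<C>) - d * real (card V) \<le> real (card {c\<in>\<C>. S c \<subseteq> U})" .
  have "d \<le> real (card {c\<in>\<C>. S c \<subseteq> U \<and> u \<in> S c})" if u: "u \<in> U" for u
  proof -
    have "{c\<in>\<C>. S c \<subseteq> U} = {c\<in>\<C>. S c \<subseteq> U - {u}} \<union> {c\<in>\<C>. S c \<subseteq> U \<and> u \<in> S c}" by auto
    then have "card {c\<in>\<C>. S c \<subseteq> U} =
        card {c\<in>\<C>. S c \<subseteq> U - {u}} + card {c\<in>\<C>. S c \<subseteq> U \<and> u \<in> S c}"
      using C by (simp only:) (rule card_Un_disjoint, auto)
    moreover have "real (card U) = real (card (U - {u})) + 1"
      using finU u by (metis card_Suc_Diff1 of_nat_Suc add.commute)
    moreover have "f (U - {u}) \<le> f U" using U by (intro max) auto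
    ultimately show ?thesis by (simp add: f_def algebra_simps)
  qed
  then show ?thesis using 1 U by blast
qed

lemma mult_le_of_mult_power_le:
  fixes \<delta> x y :: real
  assumes "0 \<le> \<delta>" "\<delta> \<le> 1" "r \<ge> 1" "0 \<le> x" "0 \<le> y" "\<delta> * x ^ r \<le> y ^ r"
  shows "\<delta> * x \<le> y"
proof -
  have "\<delta> ^ r \<le> \<delta> ^ 1" using assms by (intro power_decreasing) auto
  then have "(\<delta> * x) ^ r \<le> \<delta> * x ^ r"
    using assms by (simp add: power_mult_distrib mult_right_mono)
  also have "\<dots> \<le> y ^ r" by fact
  finally show ?thesis using assms by (metis power_mono_iff mult_nonneg_nonneg less_le_trans zero_less_one)
qed

text \<open>
  Isolated vertices of \<open>F\<close> need no separate treatment: the degree of a vertex of \<open>G\<close> counts the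
  copies that use it in any role, and the cleaned subgraph keeps whole copies only.
\<close>

lemma far_imp_uniformly_far_subgraph:
  assumes r: "r \<ge> 1" and F: "r_graph r F" "edges F \<noteq> {}"
    and G: "r_graph r G" and far: "far_from_free r \<epsilon> F G" and e: "0 < \<epsilon>" "\<epsilon> \<le> 1"
    and del: "\<delta> = \<epsilon> / (2 * real (card (edges F)) * real (card (verts F)) ^ card (verts F))"
  shows "\<exists>G' \<kappa>. verts G' \<subseteq> verts G \<and> edges G' \<subseteq> edges G \<and> r_graph r G' \<and> \<kappa> \<in> homs G' F \<and>
           uniformly_far_from_free r \<delta> F G' \<kappa> \<and> \<delta> * real (card (verts G)) \<le> real (card (verts G'))"
proof -
  define n E v where "n = real (card (verts G))" and "E = real (card (edges F))"
    and "v = real (card (verts F)) ^ card (verts F)"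
  have finG: "finite (verts G)" and finF: "finite (verts F)" using F G by (auto simp: r_graph_def)
  have Fne: "card (verts F) \<ge> 1" using uniformity_le_card_verts[OF F] r by simp
  then have Vne: "verts F \<noteq> {}" by auto
  have E: "E \<ge> 1"
  proof -
    have "card (edges F) > 0" using F finite_edges card_gt_0_iff by blast
    then show ?thesis unfolding E_def by linarith
  qed
  have v: "v \<ge> 1" unfolding v_def using Fne by simp
  have Ev: "E * v \<ge> 1" using E v by (metis mult_mono[of 1 E 1 v] mult_1 zero_le_one order_trans)
  have d0: "\<delta> = \<epsilon> / (2 * (E * v))" using del by (simp add: E_def v_def mult.assoc)
  have d: "0 < \<delta>" "\<delta> \<le> 1" using e Ev unfolding d0 by (auto simp: divide_le_eq)
  obtain \<C> where P: "packing F G \<C>" and big: "\<epsilon> * n ^ r \<le> E * real (card \<C>)"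
    using far_imp_packing[OF F G far] by (auto simp: n_def E_def)
  have CG: "\<C> \<subseteq> embs F G" using P by (simp add: packing_def)
  have finC: "finite \<C>" using CG finite_embs[OF finF finG] finite_subset by blast
  have inj: "\<And>\<psi>. \<psi> \<in> \<C> \<Longrightarrow> inj_on \<psi> (verts F)" and ext: "\<And>\<psi>. \<psi> \<in> \<C> \<Longrightarrow> \<psi> \<in> verts F \<rightarrow>\<^sub>E verts G"
    and ed: "\<And>\<psi> e. \<psi> \<in> \<C> \<Longrightarrow> e \<in> edges F \<Longrightarrow> \<psi> ` e \<in> edges G"
    using CG by (auto simp: embs_def homs_def)
  have sub: "\<psi> ` verts F \<subseteq> verts G" if "\<psi> \<in> \<C>" for \<psi> using ext[OF that] by auto
  have "\<exists>\<kappa>\<in>verts G \<rightarrow>\<^sub>E verts F.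
      card \<C> \<le> card (verts F) ^ card (verts F) * card {\<psi>\<in>\<C>. \<forall>a\<in>verts F. \<kappa> (\<psi> a) = a}"
    by (rule exists_colouring[OF finG finF Vne finC]) (intro conjI inj sub)
  then obtain \<kappa> where kap: "\<kappa> \<in> verts G \<rightarrow>\<^sub>E verts F"
    and ck: "card \<C> \<le> card (verts F) ^ card (verts F) * card {\<psi>\<in>\<C>. \<forall>a\<in>verts F. \<kappa> (\<psi> a) = a}"
    by (elim bexE)
  define \<C>1 where "\<C>1 = {\<psi>\<in>\<C>. \<forall>a\<in>verts F. \<kappa> (\<psi> a) = a}"
  have finC1: "finite \<C>1" using finC by (simp add: \<C>1_def)
  have ck': "real (card \<C>) \<le> v * real (card \<C>1)"
    using of_nat_mono[OF ck, where ?'a = real] by (simp add: \<C>1_def v_def)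
  \<comment> \<open>The factor \<open>2\<close> in the definition of \<open>\<delta>\<close> leaves \<open>\<delta> n\<^sup>r\<close> copies for the cleaning step to lose.\<close>
  have "\<epsilon> * n ^ r \<le> E * (v * real (card \<C>1))"
    using big ck' E by (meson mult_left_mono order_trans zero_le_one)
  then have c1: "2 * (\<delta> * n ^ r) \<le> real (card \<C>1)"
    using Ev unfolding d0 by (simp add: field_simps)
  define d where "d = \<delta> * n ^ (r - 1)"
  have dn: "d * n = \<delta> * n ^ r"
    unfolding d_def using r by (metis mult.assoc power_minus_mult less_le_trans zero_less_one)
  have sub1: "\<psi> ` verts F \<subseteq> verts G" if "\<psi> \<in> \<C>1" for \<psi>
    using that by (intro sub) (simp add: \<C>1_def)
  have "0 \<le> d" using \<open>0 < \<delta>\<close> by (simp add: d_def n_def)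
  have "\<exists>U\<subseteq>verts G. real (card \<C>1) - d * n \<le> real (card {\<psi>\<in>\<C>1. \<psi> ` verts F \<subseteq> U}) \<and>
      (\<forall>u\<in>U. d \<le> real (card {\<psi>\<in>\<C>1. \<psi> ` verts F \<subseteq> U \<and> u \<in> \<psi> ` verts F}))"
    unfolding n_def by (rule exists_dense_core[OF finG finC1 sub1 \<open>0 \<le> d\<close>])
  then obtain U where U: "U \<subseteq> verts G"
    and Ubig: "real (card \<C>1) - d * n \<le> real (card {\<psi>\<in>\<C>1. \<psi> ` verts F \<subseteq> U})"
    and Udeg: "\<forall>u\<in>U. d \<le> real (card {\<psi>\<in>\<C>1. \<psi> ` verts F \<subseteq> U \<and> u \<in> \<psi> ` verts F})"
    by (elim exE conjE)
  define \<C>2 where "\<C>2 = {\<psi>\<in>\<C>1. \<psi> ` verts F \<subseteq> U}"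
  define G' where "G' = \<lparr>verts = U, edges = (\<Union>\<psi>\<in>\<C>2. (`) \<psi> ` edges F)\<rparr>"
  define \<kappa>' where "\<kappa>' = restrict \<kappa> U"
  have C2: "\<C>2 \<subseteq> \<C>" by (auto simp: \<C>2_def \<C>1_def)
  have esub: "e \<subseteq> verts F" and ecard: "card e = r" if "e \<in> edges F" for e
    using F that by (auto simp: r_graph_def)
  have finU: "finite U" using U finG finite_subset by blast
  have kid: "\<kappa>' (\<psi> a) = a" if "\<psi> \<in> \<C>2" "a \<in> verts F" for \<psi> a
    using that unfolding \<kappa>'_def \<C>2_def \<C>1_def by auto
  have edG': "edges G' \<subseteq> edges G" using ed C2 by (auto simp: G'_def)
  have G': "r_graph r G'"
    unfolding r_graph_def
  proof (intro conjI ballI)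
    show "finite (verts G')" using finU by (simp add: G'_def)
    fix e assume "e \<in> edges G'"
    then obtain \<psi> f where f: "\<psi> \<in> \<C>2" "f \<in> edges F" "e = \<psi> ` f" by (auto simp: G'_def)
    then show "e \<subseteq> verts G'" using esub[OF f(2)] by (auto simp: G'_def \<C>2_def)
    show "card e = r" using f inj C2 esub ecard by (metis card_image inj_on_subset subsetD)
  qed
  have hom: "\<kappa>' \<in> homs G' F"
  proof -
    have "\<kappa>' ` \<psi> ` e \<in> edges F" if "\<psi> \<in> \<C>2" "e \<in> edges F" for \<psi> e
    proof -
      have "\<kappa>' ` \<psi> ` e = e" using kid[OF that(1)] esub[OF that(2)] by (force simp: image_iff)
      then show ?thesis using that by simp
    qed
    moreover have "\<kappa>' \<in> U \<rightarrow>\<^sub>E verts F" using kap U by (auto simp: \<kappa>'_def PiE_iff)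
    ultimately show ?thesis by (auto simp: homs_def G'_def)
  qed
  have emb: "\<C>2 \<subseteq> embs F G'"
  proof
    fix \<psi> assume p: "\<psi> \<in> \<C>2"
    then have "\<psi> \<in> verts F \<rightarrow>\<^sub>E U" using ext[of \<psi>] C2 by (auto simp: \<C>2_def PiE_iff)
    then show "\<psi> \<in> embs F G'" using p inj C2 by (auto simp: embs_def homs_def G'_def)
  qed
  have dis: "disjoint_family_on (\<lambda>\<psi>. (`) \<psi> ` edges F) \<C>2"
    using P C2 unfolding packing_def by (meson disjoint_family_on_mono)
  have n': "real (card (verts G')) \<le> n"
    unfolding n_def G'_def using card_mono[OF finG U] by simp
  have far': "uniformly_far_from_free r \<delta> F G' \<kappa>'"
    unfolding uniformly_far_from_free_def
  proof (intro exI[of _ \<C>2] conjI ballI emb dis)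
    show "\<kappa>' (\<psi> a) = a" if "\<psi> \<in> \<C>2" "a \<in> verts F" for \<psi> a using kid that by auto
    fix u assume "u \<in> verts G'"
    then have u: "u \<in> U" by (simp add: G'_def)
    have "\<delta> * real (card (verts G')) ^ (r - 1) \<le> d"
      unfolding d_def using n' \<open>0 < \<delta>\<close> by (intro mult_left_mono power_mono) auto
    also have "\<dots> \<le> real (card {\<psi>\<in>\<C>2. u \<in> \<psi> ` verts F})"
      using bspec[OF Udeg u] by (simp add: \<C>2_def conj_assoc)
    finally show "\<delta> * real (card (verts G')) ^ (r - 1) \<le> real (card {\<psi>\<in>\<C>2. u \<in> \<psi> ` verts F})" .
  qed
  have "\<delta> * n ^ r \<le> real (card \<C>2)" using Ubig c1 dn by (simp add: \<C>2_def)
  also have "real (card \<C>2) \<le> real (card (verts G') ^ r)"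
    by (rule of_nat_mono, rule card_packing_le[OF F])
      (use G' emb dis in \<open>auto simp: packing_def r_graph_def\<close>)
  finally have "\<delta> * n ^ r \<le> real (card (verts G')) ^ r" by simp
  then have "\<delta> * n \<le> real (card (verts G'))"
    by (rule mult_le_of_mult_power_le[rotated -1]) (use d r in \<open>auto simp: n_def\<close>)
  then show ?thesis using U edG' G' hom far' unfolding n_def
    by (intro exI[of _ G'] exI[of _ \<kappa>']) (auto simp: G'_def)
qed

text \<open>
  The subgraph has only \<open>\<delta>n\<close> vertices with \<open>\<delta> = \<epsilon>/K\<close>; this costs a factor \<open>\<delta>\<^bsup>v(H)\<^esup>\<close> in the count and
  is absorbed into the exponent \<open>C + v(H)\<close>.
\<close>

lemma abundant_if_abundant_col:
  fixes F :: "'a hypergraph" and H :: "'b hypergraph"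
  assumes r: "r \<ge> 1" and F: "r_graph r F" "edges F \<noteq> {}" and H: "r_graph r H"
    and ab: "abundant_col r F H \<sigma>"
  shows "abundant r F H"
proof -
  obtain c C where c: "c > 0" "C > 0" and lower:
    "\<And>\<epsilon>. 0 < \<epsilon> \<Longrightarrow> \<epsilon> \<le> 1 \<Longrightarrow> \<exists>n\<^sub>0. \<forall>(G :: nat hypergraph) \<kappa>.
        r_graph r G \<and> \<kappa> \<in> homs G F \<and> card (verts G) \<ge> n\<^sub>0 \<and> uniformly_far_from_free r \<epsilon> F G \<kappa> \<longrightarrow>
        c * \<epsilon> powr C * real (card (verts G)) ^ card (verts H) \<le> real (Emb_col H \<sigma> G \<kappa>)"
    using ab unfolding abundant_col_def by blast
  define h where "h = card (verts H)"
  define K where "K = 2 * real (card (edges F)) * real (card (verts F)) ^ card (verts F)"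
  have "card (verts F) \<ge> 1" using uniformity_le_card_verts[OF F] r by simp
  then have v: "real (card (verts F)) ^ card (verts F) \<ge> 1" by (simp add: one_le_power)
  have "card (edges F) > 0" using F finite_edges card_gt_0_iff by blast
  then have "real (card (edges F)) \<ge> 1" by linarith
  then have "1 * 1 \<le> real (card (edges F)) * real (card (verts F)) ^ card (verts F)"
    using v by (intro mult_mono) auto
  then have K: "K \<ge> 1" unfolding K_def by linarith
  show ?thesis
    unfolding abundant_def
  proof (rule exI[of _ "c / K powr (C + real h)"], rule exI[of _ "C + real h"], intro conjI allI impI)
    show "c / K powr (C + real h) > 0" "C + real h > 0" using c K by auto
    fix \<epsilon> :: real assume e: "0 < \<epsilon> \<and> \<epsilon> \<le> 1"
    define \<delta> where "\<delta> = \<epsilon> / K"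
    have d: "0 < \<delta>" "\<delta> \<le> 1" using e K by (auto simp: \<delta>_def divide_le_eq)
    obtain n0 where n0: "\<And>(G :: nat hypergraph) \<kappa>.
        r_graph r G \<Longrightarrow> \<kappa> \<in> homs G F \<Longrightarrow> card (verts G) \<ge> n0 \<Longrightarrow> uniformly_far_from_free r \<delta> F G \<kappa> \<Longrightarrow>
        c * \<delta> powr C * real (card (verts G)) ^ h \<le> real (Emb_col H \<sigma> G \<kappa>)"
      using lower[OF d] unfolding h_def by blast
    show "\<exists>n\<^sub>0. \<forall>G :: nat hypergraph.
            r_graph r G \<and> card (verts G) \<ge> n\<^sub>0 \<and> far_from_free r \<epsilon> F G \<longrightarrow>
            c / K powr (C + real h) * \<epsilon> powr (C + real h) * real (card (verts G)) ^ card (verts H)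
              \<le> real (Emb H G)"
    proof (intro exI[of _ "nat \<lceil>real n0 / \<delta>\<rceil>"] allI impI)
      fix G :: "nat hypergraph"
      assume "r_graph r G \<and> card (verts G) \<ge> nat \<lceil>real n0 / \<delta>\<rceil> \<and> far_from_free r \<epsilon> F G"
      then have G: "r_graph r G" and n: "card (verts G) \<ge> nat \<lceil>real n0 / \<delta>\<rceil>" and far: "far_from_free r \<epsilon> F G"
        by auto
      obtain G' \<kappa> where G': "verts G' \<subseteq> verts G" "edges G' \<subseteq> edges G" "r_graph r G'" "\<kappa> \<in> homs G' F"
        "uniformly_far_from_free r \<delta> F G' \<kappa>" and size: "\<delta> * real (card (verts G)) \<le> real (card (verts G'))"
        using far_imp_uniformly_far_subgraph[OF r F G far, of \<delta>] e unfolding \<delta>_def K_def by auto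
      have "real n0 / \<delta> \<le> real (card (verts G))" using n by linarith
      then have "real n0 \<le> \<delta> * real (card (verts G))" using d by (simp add: field_simps)
      then have n': "n0 \<le> card (verts G')" using size by linarith
      have "c / K powr (C + real h) * \<epsilon> powr (C + real h) = c * \<delta> powr C * \<delta> ^ h"
        using e K d by (simp add: \<delta>_def powr_divide powr_add powr_realpow field_simps)
      then have "c / K powr (C + real h) * \<epsilon> powr (C + real h) * real (card (verts G)) ^ h
          = c * \<delta> powr C * (\<delta> * real (card (verts G))) ^ h"
        by (simp add: power_mult_distrib)
      also have "\<dots> \<le> c * \<delta> powr C * real (card (verts G')) ^ h"
        using size d c by (intro mult_left_mono power_mono) auto
      also have "\<dots> \<le> real (Emb_col H \<sigma> G' \<kappa>)" by (rule n0) (use G' n' in auto)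
      also have "real (Emb_col H \<sigma> G' \<kappa>) \<le> real (Emb H G)"
        unfolding Emb_col_def Emb_def
      proof (rule of_nat_mono, rule card_mono)
        show "finite (embs H G)" using G H finite_embs by (auto simp: r_graph_def)
        show "{\<phi> \<in> embs H G'. \<forall>v\<in>verts H. \<kappa> (\<phi> v) = \<sigma> v} \<subseteq> embs H G"
          using G'(1,2) unfolding embs_def homs_def by (auto simp: PiE_iff)
      qed
      finally show "c / K powr (C + real h) * \<epsilon> powr (C + real h) * real (card (verts G)) ^ card (verts H)
              \<le> real (Emb H G)" by (simp add: h_def)
    qed
  qed
qed

section \<open>Sparse hosts and their products over \<open>F\<close>\<close>

text \<open>
  Products of hosts behave well for homomorphisms, whereas a pair of non-injective maps may combine
  into an embedding; hence homomorphisms rather than embeddings are counted from here on.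
\<close>

definition col_homs ::
  "'c hypergraph \<Rightarrow> 'b hypergraph \<Rightarrow> ('b \<Rightarrow> 'a) \<Rightarrow> ('c \<Rightarrow> 'a) \<Rightarrow> ('c \<Rightarrow> 'b) set" where
  "col_homs H G \<kappa> \<sigma> = {\<phi> \<in> homs H G. \<forall>v\<in>verts H. \<kappa> (\<phi> v) = \<sigma> v}"

definition partite_packing :: "'a hypergraph \<Rightarrow> 'b hypergraph \<Rightarrow> ('b \<Rightarrow> 'a) \<Rightarrow> ('a \<Rightarrow> 'b) set \<Rightarrow> bool" where
  "partite_packing F G \<kappa> \<C> \<longleftrightarrow> packing F G \<C> \<and> (\<forall>\<psi>\<in>\<C>. \<forall>a\<in>verts F. \<kappa> (\<psi> a) = a)"

text \<open>
  The densities \<open>\<eta>\<close> and \<open>\<gamma>\<close> refer to a nominal size \<open>N \<ge> |V(G)|\<close>. In a product, vertices with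
  incompatible colours are absent, so \<open>|V(G)|\<close> is only submultiplicative, while nominal sizes simply
  multiply. Nothing substantial is lost: for \<open>\<eta> \<le> 1\<close> the packing forces \<open>|V(G)| \<ge> \<eta> N\<close>.
\<close>

definition sparse_host ::
  "nat \<Rightarrow> 'a hypergraph \<Rightarrow> 'b hypergraph \<Rightarrow> real \<Rightarrow> (('b \<Rightarrow> 'a) \<Rightarrow> real) \<Rightarrow>
    nat hypergraph \<Rightarrow> (nat \<Rightarrow> 'a) \<Rightarrow> real \<Rightarrow> bool" where
  "sparse_host r F H \<eta> \<gamma> G \<kappa> N \<longleftrightarrow>
     r_graph r G \<and> \<kappa> \<in> homs G F \<and> real (card (verts G)) \<le> N \<and>
     (\<exists>\<C>. partite_packing F G \<kappa> \<C> \<and> \<eta> * N ^ r \<le> real (card \<C>)) \<and>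
     (\<forall>\<sigma>\<in>homs H F. real (card (col_homs H G \<kappa> \<sigma>)) \<le> \<gamma> \<sigma> * N ^ card (verts H))"

definition has_sparse_hosts ::
  "nat \<Rightarrow> 'a hypergraph \<Rightarrow> 'b hypergraph \<Rightarrow> real \<Rightarrow> (('b \<Rightarrow> 'a) \<Rightarrow> real) \<Rightarrow> bool" where
  "has_sparse_hosts r F H \<eta> \<gamma> \<longleftrightarrow> (\<forall>n\<^sub>0. \<exists>G \<kappa> N. n\<^sub>0 \<le> N \<and> sparse_host r F H \<eta> \<gamma> G \<kappa> N)"

lemma has_sparse_hosts_mono:
  assumes "has_sparse_hosts r F H \<eta> \<gamma>" "\<eta>' \<le> \<eta>" "\<And>\<sigma>. \<sigma> \<in> homs H F \<Longrightarrow> \<gamma> \<sigma> \<le> \<gamma>' \<sigma>"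
  shows "has_sparse_hosts r F H \<eta>' \<gamma>'"
proof -
  have "sparse_host r F H \<eta>' \<gamma>' G \<kappa> N" if h: "sparse_host r F H \<eta> \<gamma> G \<kappa> N" for G \<kappa> N
  proof -
    have N: "0 \<le> N" using h unfolding sparse_host_def by (meson of_nat_0_le_iff order_trans)
    have "\<eta>' * N ^ r \<le> \<eta> * N ^ r" using N assms(2) by (simp add: mult_right_mono)
    moreover have "\<gamma> \<sigma> * N ^ card (verts H) \<le> \<gamma>' \<sigma> * N ^ card (verts H)" if "\<sigma> \<in> homs H F" for \<sigma>
      using N assms(3)[OF that] by (simp add: mult_right_mono)
    ultimately show ?thesis using h unfolding sparse_host_def by (meson order_trans)
  qed
  then show ?thesis using assms(1) unfolding has_sparse_hosts_def by meson
qed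

abbreviation pfst :: "nat \<Rightarrow> nat" where "pfst z \<equiv> fst (prod_decode z)"
abbreviation psnd :: "nat \<Rightarrow> nat" where "psnd z \<equiv> snd (prod_decode z)"

text \<open>
  The fibre product of \<open>G\<^sub>1\<close> and \<open>G\<^sub>2\<close> over \<open>F\<close>, with pairs encoded as natural numbers so that powers
  of a host have the same type as the host.
\<close>

definition partite_product ::
  "nat \<Rightarrow> nat hypergraph \<Rightarrow> (nat \<Rightarrow> 'a) \<Rightarrow> nat hypergraph \<Rightarrow> (nat \<Rightarrow> 'a) \<Rightarrow> nat hypergraph" where
  "partite_product r G\<^sub>1 \<kappa>\<^sub>1 G\<^sub>2 \<kappa>\<^sub>2 =
     (let V = {z. pfst z \<in> verts G\<^sub>1 \<and> psnd z \<in> verts G\<^sub>2 \<and> \<kappa>\<^sub>1 (pfst z) = \<kappa>\<^sub>2 (psnd z)}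
      in \<lparr>verts = V, edges = {e. e \<subseteq> V \<and> card e = r \<and> pfst ` e \<in> edges G\<^sub>1 \<and> psnd ` e \<in> edges G\<^sub>2}\<rparr>)"

context
  fixes r :: nat and F :: "'a hypergraph" and G1 G2 :: "nat hypergraph" and \<kappa>1 \<kappa>2 :: "nat \<Rightarrow> 'a"
  assumes F: "r_graph r F"
    and G1: "r_graph r G1" "\<kappa>1 \<in> homs G1 F" and G2: "r_graph r G2" "\<kappa>2 \<in> homs G2 F"
begin

private abbreviation "P \<equiv> partite_product r G1 \<kappa>1 G2 \<kappa>2"
private abbreviation "\<kappa> \<equiv> restrict (\<lambda>z. \<kappa>1 (pfst z)) (verts P)"

lemma verts_partite_product_subset: "verts P \<subseteq> prod_encode ` (verts G1 \<times> verts G2)"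
proof
  fix z assume "z \<in> verts P"
  then have "prod_decode z \<in> verts G1 \<times> verts G2"
    by (auto simp: partite_product_def Let_def mem_Times_iff)
  then have "prod_encode (prod_decode z) \<in> prod_encode ` (verts G1 \<times> verts G2)" by (rule imageI)
  then show "z \<in> prod_encode ` (verts G1 \<times> verts G2)" by simp
qed

lemma finite_verts_partite_product: "finite (verts P)"
  using verts_partite_product_subset by (rule finite_subset) (use G1 G2 in \<open>simp add: r_graph_def\<close>)

lemma card_verts_partite_product: "card (verts P) \<le> card (verts G1) * card (verts G2)"
proof -
  have "card (verts P) \<le> card (prod_encode ` (verts G1 \<times> verts G2))"
    by (rule card_mono[OF _ verts_partite_product_subset]) (use G1 G2 in \<open>simp add: r_graph_def\<close>)
  then show ?thesis by (simp add: card_image inj_prod_encode card_cartesian_product)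
qed

lemma r_graph_partite_product: "r_graph r P"
  using finite_verts_partite_product by (auto simp: r_graph_def partite_product_def Let_def)

lemma colouring_partite_product: "\<kappa> \<in> homs P F"
proof -
  have "\<kappa> ` e \<in> edges F" if e: "e \<in> edges P" for e
  proof -
    have "e \<subseteq> verts P" and 1: "pfst ` e \<in> edges G1"
      using e by (auto simp: partite_product_def Let_def)
    then have "\<kappa> ` e = \<kappa>1 ` (pfst ` e)" by (force simp: image_image)
    then show ?thesis using 1 G1(2) by (auto simp: homs_def)
  qed
  moreover have "\<kappa> \<in> verts P \<rightarrow>\<^sub>E verts F"
    using G1(2) by (auto simp: homs_def PiE_iff partite_product_def Let_def)
  ultimately show ?thesis by (simp add: homs_def)
qed

text \<open>A homomorphism into the product is determined by its two projections.\<close>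

lemma card_col_homs_partite_product:
  assumes H: "r_graph r H"
  shows "card (col_homs H P \<kappa> \<sigma>) \<le> card (col_homs H G1 \<kappa>1 \<sigma>) * card (col_homs H G2 \<kappa>2 \<sigma>)"
proof -
  define f where "f \<phi> = (restrict (\<lambda>v. pfst (\<phi> v)) (verts H), restrict (\<lambda>v. psnd (\<phi> v)) (verts H))"
    for \<phi> :: "'b \<Rightarrow> nat"
  have fin: "finite (col_homs H G1 \<kappa>1 \<sigma>)" "finite (col_homs H G2 \<kappa>2 \<sigma>)"
    using H G1(1) G2(1) by (simp_all add: col_homs_def r_graph_def finite_homs)
  have "inj_on f (col_homs H P \<kappa> \<sigma>)"
  proof (rule inj_onI)
    fix \<phi> \<phi>' assume *: "\<phi> \<in> col_homs H P \<kappa> \<sigma>" "\<phi>' \<in> col_homs H P \<kappa> \<sigma>" "f \<phi> = f \<phi>'"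
    show "\<phi> = \<phi>'"
    proof (rule PiE_ext)
      show "\<phi> \<in> verts H \<rightarrow>\<^sub>E verts P" "\<phi>' \<in> verts H \<rightarrow>\<^sub>E verts P"
        using * by (auto simp: col_homs_def homs_def)
      fix v assume v: "v \<in> verts H"
      have "pfst (\<phi> v) = pfst (\<phi>' v)" "psnd (\<phi> v) = psnd (\<phi>' v)"
        using fun_cong[OF arg_cong[OF *(3), of fst], of v] fun_cong[OF arg_cong[OF *(3), of snd], of v] v
        by (simp_all add: f_def)
      then have "prod_decode (\<phi> v) = prod_decode (\<phi>' v)" by (simp add: prod_eq_iff)
      then show "\<phi> v = \<phi>' v" by (metis prod_decode_inverse)
    qed
  qed
  moreover have "f ` col_homs H P \<kappa> \<sigma> \<subseteq> col_homs H G1 \<kappa>1 \<sigma> \<times> col_homs H G2 \<kappa>2 \<sigma>"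
  proof
    fix y assume "y \<in> f ` col_homs H P \<kappa> \<sigma>"
    then obtain \<phi> where phi: "\<phi> \<in> col_homs H P \<kappa> \<sigma>" "y = f \<phi>" by (rule imageE)
    have in_P: "\<phi> v \<in> verts P" if "v \<in> verts H" for v
      using phi(1) that by (auto simp: col_homs_def homs_def PiE_iff)
    have V: "pfst (\<phi> v) \<in> verts G1" "psnd (\<phi> v) \<in> verts G2" "\<kappa>1 (pfst (\<phi> v)) = \<kappa>2 (psnd (\<phi> v))"
      "\<kappa>1 (pfst (\<phi> v)) = \<sigma> v" if "v \<in> verts H" for v
      using in_P[OF that] phi(1) that by (auto simp: col_homs_def partite_product_def Let_def)
    have E: "pfst ` \<phi> ` e \<in> edges G1" "psnd ` \<phi> ` e \<in> edges G2" if "e \<in> edges H" for e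
      using phi(1) that by (auto simp: col_homs_def homs_def partite_product_def Let_def)
    have R: "restrict (\<lambda>v. g (\<phi> v)) (verts H) ` e = g ` \<phi> ` e" if "e \<in> edges H" for e and g :: "nat \<Rightarrow> nat"
    proof -
      have "e \<subseteq> verts H" using H that by (auto simp: r_graph_def)
      then show ?thesis by (force simp: image_image)
    qed
    have E': "restrict (\<lambda>v. pfst (\<phi> v)) (verts H) ` e \<in> edges G1"
      "restrict (\<lambda>v. psnd (\<phi> v)) (verts H) ` e \<in> edges G2" if "e \<in> edges H" for e
      using R[OF that, of pfst] R[OF that, of psnd] E[OF that] by simp_all
    show "y \<in> col_homs H G1 \<kappa>1 \<sigma> \<times> col_homs H G2 \<kappa>2 \<sigma>"
      unfolding phi(2) f_def col_homs_def homs_def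
      by (intro SigmaI CollectI conjI ballI E') (use V in auto)
  qed
  ultimately have "card (col_homs H P \<kappa> \<sigma>) \<le> card (col_homs H G1 \<kappa>1 \<sigma> \<times> col_homs H G2 \<kappa>2 \<sigma>)"
    by (rule card_inj_on_le) (use fin in simp)
  then show ?thesis by (simp add: card_cartesian_product)
qed

text \<open>
  The copies \<open>a \<mapsto> (\<psi>\<^sub>1 a, \<psi>\<^sub>2 a)\<close> are edge-disjoint because an edge shared by two of them projects to
  a shared edge in each factor, where it identifies the two components.
\<close>

lemma partite_packing_partite_product:
  assumes C1: "partite_packing F G1 \<kappa>1 \<C>1" and C2: "partite_packing F G2 \<kappa>2 \<C>2"
  shows "\<exists>\<C>. partite_packing F P \<kappa> \<C> \<and> card \<C> = card \<C>1 * card \<C>2"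
proof -
  define f where "f \<psi> = restrict (\<lambda>a. prod_encode (fst \<psi> a, snd \<psi> a)) (verts F)"
    for \<psi> :: "('a \<Rightarrow> nat) \<times> ('a \<Rightarrow> nat)"
  have ext: "fst \<psi> \<in> verts F \<rightarrow>\<^sub>E verts G1" "snd \<psi> \<in> verts F \<rightarrow>\<^sub>E verts G2"
    and col: "\<And>a. a \<in> verts F \<Longrightarrow> \<kappa>1 (fst \<psi> a) = a \<and> \<kappa>2 (snd \<psi> a) = a"
    and edg: "\<And>e. e \<in> edges F \<Longrightarrow> fst \<psi> ` e \<in> edges G1 \<and> snd \<psi> ` e \<in> edges G2"
    if "\<psi> \<in> \<C>1 \<times> \<C>2" for \<psi>
  proof -
    have "fst \<psi> \<in> \<C>1" "snd \<psi> \<in> \<C>2" using that by auto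
    then have "fst \<psi> \<in> embs F G1" "snd \<psi> \<in> embs F G2"
      and col: "\<forall>a\<in>verts F. \<kappa>1 (fst \<psi> a) = a" "\<forall>a\<in>verts F. \<kappa>2 (snd \<psi> a) = a"
      using C1 C2 by (auto simp: partite_packing_def packing_def)
    then show "fst \<psi> \<in> verts F \<rightarrow>\<^sub>E verts G1" "snd \<psi> \<in> verts F \<rightarrow>\<^sub>E verts G2"
      "\<And>e. e \<in> edges F \<Longrightarrow> fst \<psi> ` e \<in> edges G1 \<and> snd \<psi> ` e \<in> edges G2"
      by (simp_all add: embs_def homs_def)
    show "\<And>a. a \<in> verts F \<Longrightarrow> \<kappa>1 (fst \<psi> a) = a \<and> \<kappa>2 (snd \<psi> a) = a" using col by simp
  qed
  have esub: "e \<subseteq> verts F" and ecard: "card e = r" if "e \<in> edges F" for e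
    using F that by (auto simp: r_graph_def)
  have im: "pfst ` f \<psi> ` e = fst \<psi> ` e" "psnd ` f \<psi> ` e = snd \<psi> ` e" if "e \<in> edges F" for \<psi> e
    using esub[OF that] unfolding f_def by (force simp: image_image)+
  have emb: "f \<psi> \<in> embs F P" and kid: "\<forall>a\<in>verts F. \<kappa> (f \<psi> a) = a" if psi: "\<psi> \<in> \<C>1 \<times> \<C>2" for \<psi>
  proof -
    have V: "f \<psi> a \<in> verts P" if "a \<in> verts F" for a
      using ext[OF psi] col[OF psi that] that
      by (auto simp: f_def partite_product_def Let_def PiE_iff)
    show kid: "\<forall>a\<in>verts F. \<kappa> (f \<psi> a) = a"
    proof
      fix a assume a: "a \<in> verts F"
      have "\<kappa> (f \<psi> a) = \<kappa>1 (pfst (f \<psi> a))" using V[OF a] by simp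
      then show "\<kappa> (f \<psi> a) = a" using a col[OF psi a] by (simp add: f_def)
    qed
    have inj: "inj_on (f \<psi>) (verts F)" using kid by (metis inj_on_def)
    have "f \<psi> ` e \<in> edges P" if e: "e \<in> edges F" for e
    proof -
      have "f \<psi> ` e \<subseteq> verts P" using V esub[OF e] by auto
      moreover have "card (f \<psi> ` e) = r"
        using card_image[OF inj_on_subset[OF inj esub[OF e]]] ecard[OF e] by simp
      ultimately show ?thesis using im[OF e, of \<psi>] edg[OF psi e]
        by (simp add: partite_product_def Let_def)
    qed
    moreover have "f \<psi> \<in> verts F \<rightarrow>\<^sub>E verts P" using V by (simp add: PiE_iff f_def)
    ultimately show "f \<psi> \<in> embs F P" using inj by (simp add: embs_def homs_def)
  qed
  have eq: "\<psi> = \<psi>'"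
    if "\<psi> \<in> \<C>1 \<times> \<C>2" "\<psi>' \<in> \<C>1 \<times> \<C>2" "e \<in> edges F" "e' \<in> edges F" "f \<psi> ` e = f \<psi>' ` e'" for \<psi> \<psi>' e e'
  proof -
    have "fst \<psi> ` e = fst \<psi>' ` e'" "snd \<psi> ` e = snd \<psi>' ` e'"
      using im[OF that(3), of \<psi>] im[OF that(4), of \<psi>'] that(5) by simp_all
    then have "fst \<psi> = fst \<psi>'" "snd \<psi> = snd \<psi>'"
      using that(1-4) C1 C2 packing_eqI[of F G1 \<C>1 "fst \<psi>" "fst \<psi>'" e e']
        packing_eqI[of F G2 \<C>2 "snd \<psi>" "snd \<psi>'" e e'] by (auto simp: partite_packing_def)
    then show ?thesis by (simp add: prod_eq_iff)
  qed
  have inj: "inj_on f (\<C>1 \<times> \<C>2)"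
  proof (rule inj_onI)
    fix \<psi> \<psi>' assume *: "\<psi> \<in> \<C>1 \<times> \<C>2" "\<psi>' \<in> \<C>1 \<times> \<C>2" "f \<psi> = f \<psi>'"
    have "fst \<psi> a = fst \<psi>' a \<and> snd \<psi> a = snd \<psi>' a" if "a \<in> verts F" for a
    proof -
      have "f \<psi> a = f \<psi>' a" using *(3) by simp
      then show ?thesis using that by (simp add: f_def)
    qed
    then have "fst \<psi> = fst \<psi>'" "snd \<psi> = snd \<psi>'"
      using ext[OF *(1)] ext[OF *(2)] by (auto intro: PiE_ext)
    then show "\<psi> = \<psi>'" by (simp add: prod_eq_iff)
  qed
  have "disjoint_family_on (\<lambda>\<psi>. (`) \<psi> ` edges F) (f ` (\<C>1 \<times> \<C>2))"
    unfolding disjoint_family_on_def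
  proof (intro ballI impI)
    fix m n assume "m \<in> f ` (\<C>1 \<times> \<C>2)" "n \<in> f ` (\<C>1 \<times> \<C>2)" and ne: "m \<noteq> n"
    then obtain \<psi> \<psi>' where p: "\<psi> \<in> \<C>1 \<times> \<C>2" "m = f \<psi>" "\<psi>' \<in> \<C>1 \<times> \<C>2" "n = f \<psi>'" by (elim imageE)
    show "(`) m ` edges F \<inter> (`) n ` edges F = {}"
    proof (rule ccontr)
      assume "(`) m ` edges F \<inter> (`) n ` edges F \<noteq> {}"
      then obtain e e' where "e \<in> edges F" "e' \<in> edges F" "m ` e = n ` e'" by auto
      then have "\<psi> = \<psi>'" using eq[OF p(1,3)] p by simp
      then show False using ne p by simp
    qed
  qed
  moreover have "\<forall>a\<in>verts F. \<kappa> (\<psi> a) = a" if im: "\<psi> \<in> f ` (\<C>1 \<times> \<C>2)" for \<psi>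
  proof -
    obtain z where z: "\<psi> = f z" "z \<in> \<C>1 \<times> \<C>2" using im by (rule imageE)
    show ?thesis unfolding z(1) by (rule kid[OF z(2)])
  qed
  ultimately have "partite_packing F P \<kappa> (f ` (\<C>1 \<times> \<C>2))"
    unfolding partite_packing_def packing_def by (intro conjI ballI[of _ "\<lambda>\<psi>. \<forall>a\<in>verts F. \<kappa> (\<psi> a) = a"] image_subsetI emb)
  moreover have "card (f ` (\<C>1 \<times> \<C>2)) = card \<C>1 * card \<C>2"
    using card_image[OF inj] by (simp add: card_cartesian_product)
  ultimately show ?thesis by (intro exI conjI)
qed

end

lemma has_sparse_hosts_mult:
  assumes F: "r_graph r F" and H: "r_graph r H" and \<eta>: "0 \<le> \<eta>1" "0 \<le> \<eta>2"
    and h1: "has_sparse_hosts r F H \<eta>1 \<gamma>1" and h2: "has_sparse_hosts r F H \<eta>2 \<gamma>2"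
  shows "has_sparse_hosts r F H (\<eta>1 * \<eta>2) (\<lambda>\<sigma>. \<gamma>1 \<sigma> * \<gamma>2 \<sigma>)"
  unfolding has_sparse_hosts_def
proof
  fix n0 :: real
  obtain G1 \<kappa>1 N1 where N1: "max n0 0 \<le> N1" and s1: "sparse_host r F H \<eta>1 \<gamma>1 G1 \<kappa>1 N1"
    using h1 unfolding has_sparse_hosts_def by meson
  obtain G2 \<kappa>2 N2 where N2: "1 \<le> N2" and s2: "sparse_host r F H \<eta>2 \<gamma>2 G2 \<kappa>2 N2"
    using h2 unfolding has_sparse_hosts_def by meson
  have g1: "r_graph r G1" "\<kappa>1 \<in> homs G1 F" and g2: "r_graph r G2" "\<kappa>2 \<in> homs G2 F"
    using s1 s2 by (auto simp: sparse_host_def)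
  define P where "P = partite_product r G1 \<kappa>1 G2 \<kappa>2"
  define \<kappa> where "\<kappa> = restrict (\<lambda>z. \<kappa>1 (pfst z)) (verts P)"
  note defs = P_def \<kappa>_def
  obtain \<C>1 where C1: "partite_packing F G1 \<kappa>1 \<C>1" "\<eta>1 * N1 ^ r \<le> real (card \<C>1)"
    using s1 by (auto simp: sparse_host_def)
  obtain \<C>2 where C2: "partite_packing F G2 \<kappa>2 \<C>2" "\<eta>2 * N2 ^ r \<le> real (card \<C>2)"
    using s2 by (auto simp: sparse_host_def)
  have "\<exists>\<C>. partite_packing F P \<kappa> \<C> \<and> card \<C> = card \<C>1 * card \<C>2"
    unfolding defs by (rule partite_packing_partite_product[OF F g1 g2 C1(1) C2(1)])
  then obtain \<C> where C: "partite_packing F P \<kappa> \<C>" "card \<C> = card \<C>1 * card \<C>2" by (elim exE conjE)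
  have "\<eta>1 * N1 ^ r * (\<eta>2 * N2 ^ r) \<le> real (card \<C>1) * real (card \<C>2)"
    using C1 C2 \<eta> N2 by (intro mult_mono) auto
  then have big: "\<eta>1 * \<eta>2 * (N1 * N2) ^ r \<le> real (card \<C>)"
    by (simp add: C(2) power_mult_distrib mult_ac)
  have "real (card (verts P)) \<le> real (card (verts G1)) * real (card (verts G2))"
    using of_nat_mono[OF card_verts_partite_product[OF F g1 g2], where ?'a = real]
    by (simp add: P_def)
  also have "\<dots> \<le> N1 * N2" using s1 s2 N1 by (intro mult_mono) (auto simp: sparse_host_def)
  finally have V: "real (card (verts P)) \<le> N1 * N2" .
  have few: "real (card (col_homs H P \<kappa> \<sigma>)) \<le> \<gamma>1 \<sigma> * \<gamma>2 \<sigma> * (N1 * N2) ^ card (verts H)"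
    if "\<sigma> \<in> homs H F" for \<sigma>
  proof -
    have 1: "real (card (col_homs H G1 \<kappa>1 \<sigma>)) \<le> \<gamma>1 \<sigma> * N1 ^ card (verts H)"
      and 2: "real (card (col_homs H G2 \<kappa>2 \<sigma>)) \<le> \<gamma>2 \<sigma> * N2 ^ card (verts H)"
      using s1 s2 that by (auto simp: sparse_host_def)
    have "real (card (col_homs H P \<kappa> \<sigma>)) \<le>
        real (card (col_homs H G1 \<kappa>1 \<sigma>)) * real (card (col_homs H G2 \<kappa>2 \<sigma>))"
      using of_nat_mono[OF card_col_homs_partite_product[OF F g1 g2 H, of \<sigma>], where ?'a = real]
      by (simp add: defs)
    also have "\<dots> \<le> (\<gamma>1 \<sigma> * N1 ^ card (verts H)) * (\<gamma>2 \<sigma> * N2 ^ card (verts H))"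
      by (rule mult_mono[OF 1 2]) (rule order_trans[OF _ 1], simp_all)
    finally show ?thesis by (simp add: power_mult_distrib mult_ac)
  qed
  have "n0 \<le> N1" "0 \<le> N1" using N1 by auto
  then have "N1 * 1 \<le> N1 * N2" using N2 by (intro mult_left_mono)
  then have "n0 \<le> N1 * N2" using \<open>n0 \<le> N1\<close> by simp
  moreover have "sparse_host r F H (\<eta>1 * \<eta>2) (\<lambda>\<sigma>. \<gamma>1 \<sigma> * \<gamma>2 \<sigma>) P \<kappa> (N1 * N2)"
    unfolding sparse_host_def
  proof (intro conjI V ballI few exI[of _ \<C>] C(1) big)
    show "r_graph r P" unfolding P_def by (rule r_graph_partite_product[OF F g1 g2])
    show "\<kappa> \<in> homs P F" unfolding defs by (rule colouring_partite_product[OF F g1 g2])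
  qed
  ultimately show "\<exists>G \<kappa> N. n0 \<le> N \<and> sparse_host r F H (\<eta>1 * \<eta>2) (\<lambda>\<sigma>. \<gamma>1 \<sigma> * \<gamma>2 \<sigma>) G \<kappa> N"
    by (intro exI conjI)
qed

lemma has_sparse_hosts_prod:
  assumes F: "r_graph r F" and H: "r_graph r H" and \<eta>: "0 \<le> \<eta>" and S: "finite S" "S \<noteq> {}"
    and h: "\<And>s. s \<in> S \<Longrightarrow> has_sparse_hosts r F H \<eta> (\<gamma> s)"
  shows "has_sparse_hosts r F H (\<eta> ^ card S) (\<lambda>\<sigma>. \<Prod>s\<in>S. \<gamma> s \<sigma>)"
  using S h
proof (induction S rule: finite_ne_induct)
  case (singleton x)
  then show ?case by simp
next
  case (insert x S)
  have "has_sparse_hosts r F H (\<eta> * \<eta> ^ card S) (\<lambda>\<sigma>. \<gamma> x \<sigma> * (\<Prod>s\<in>S. \<gamma> s \<sigma>))"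
    using insert \<eta> by (intro has_sparse_hosts_mult[OF F H]) auto
  then show ?case using insert by simp
qed

section \<open>From abundance to an abundant colouring\<close>

text \<open>
  A non-injective map has a coincidence \<open>\<phi> x = \<phi> y\<close>. Given \<open>x\<close> and \<open>y\<close>, the value at \<open>x\<close> can be
  overwritten freely and recovered from the value at \<open>y\<close>, which makes such maps a fraction of at
  most \<open>1 / |Y|\<close> of all maps. The bound is in product form to cover \<open>Y = {}\<close> and \<open>X = {}\<close>.
\<close>

lemma card_non_injective:
  assumes X: "finite X" and Y: "finite Y"
  shows "card {\<phi> \<in> X \<rightarrow>\<^sub>E Y. \<not> inj_on \<phi> X} * card Y \<le> card X ^ 2 * card Y ^ card X"
proof -
  define A where "A p = {\<phi> \<in> X \<rightarrow>\<^sub>E Y. \<phi> (fst p) = \<phi> (snd p)}" for p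
  define Q where "Q = {p \<in> X \<times> X. fst p \<noteq> snd p}"
  have fin: "finite (X \<rightarrow>\<^sub>E Y)" using X Y by (intro finite_PiE) auto
  have Q: "finite Q" "card Q \<le> card X ^ 2"
    using X card_mono[of "X \<times> X" Q] unfolding Q_def by (auto simp: power2_eq_square card_cartesian_product)
  have one: "card (A p) * card Y \<le> card Y ^ card X" if p: "p \<in> Q" for p
  proof -
    obtain x y where xy: "p = (x, y)" "x \<in> X" "y \<in> X" "x \<noteq> y" using p unfolding Q_def by auto
    have "inj_on (\<lambda>z. (fst z)(x := snd z)) (A p \<times> Y)"
    proof (rule inj_onI)
      fix z z' assume z: "z \<in> A p \<times> Y" "z' \<in> A p \<times> Y" "(fst z)(x := snd z) = (fst z')(x := snd z')"
      have "fst z u = fst z' u" for u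
        using fun_cong[OF z(3), of u] fun_cong[OF z(3), of y] z(1,2) xy
        by (cases "u = x") (auto simp: A_def)
      moreover have "snd z = snd z'" using fun_cong[OF z(3), of x] by simp
      ultimately show "z = z'" by (simp add: prod_eq_iff fun_eq_iff)
    qed
    moreover have "(\<lambda>z. (fst z)(x := snd z)) ` (A p \<times> Y) \<subseteq> X \<rightarrow>\<^sub>E Y"
      using xy by (auto simp: A_def PiE_iff extensional_def)
    ultimately have "card (A p \<times> Y) \<le> card (X \<rightarrow>\<^sub>E Y)" by (rule card_inj_on_le) (rule fin)
    then show ?thesis using X by (simp add: card_cartesian_product card_PiE)
  qed
  have "card {\<phi> \<in> X \<rightarrow>\<^sub>E Y. \<not> inj_on \<phi> X} \<le> card (\<Union>p\<in>Q. A p)"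
  proof (rule card_mono)
    show "finite (\<Union>p\<in>Q. A p)" by (rule finite_subset[OF _ fin]) (auto simp: A_def)
    show "{\<phi> \<in> X \<rightarrow>\<^sub>E Y. \<not> inj_on \<phi> X} \<subseteq> (\<Union>p\<in>Q. A p)"
      by (force simp: inj_on_def Q_def A_def)
  qed
  also have "\<dots> \<le> (\<Sum>p\<in>Q. card (A p))" by (rule card_UN_le[OF Q(1)])
  finally have "card {\<phi> \<in> X \<rightarrow>\<^sub>E Y. \<not> inj_on \<phi> X} * card Y \<le> (\<Sum>p\<in>Q. card (A p)) * card Y"
    by (rule mult_le_mono1)
  also have "\<dots> = (\<Sum>p\<in>Q. card (A p) * card Y)" by (simp add: sum_distrib_right)
  also have "\<dots> \<le> card Q * card Y ^ card X"
    using sum_mono[of Q "\<lambda>p. card (A p) * card Y" "\<lambda>_. card Y ^ card X", OF one] by simp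
  also have "\<dots> \<le> card X ^ 2 * card Y ^ card X" using Q(2) by (rule mult_le_mono1)
  finally show ?thesis .
qed

text \<open>Sum the degree condition over all vertices: each copy is counted \<open>v(F)\<close> times.\<close>

lemma uniformly_far_imp_partite_packing:
  assumes r: "r \<ge> 1" and F: "r_graph r F" and G: "r_graph r G"
    and far: "uniformly_far_from_free r \<epsilon> F G \<kappa>"
  shows "\<exists>\<C>. partite_packing F G \<kappa> \<C> \<and> \<epsilon> * real (card (verts G)) ^ r \<le> real (card \<C>) * real (card (verts F))"
proof -
  have fin: "finite (verts G)" "finite (verts F)" using F G by (auto simp: r_graph_def)
  obtain \<C> where C: "\<C> \<subseteq> embs F G" "disjoint_family_on (\<lambda>\<psi>. (`) \<psi> ` edges F) \<C>"
    "\<forall>\<psi>\<in>\<C>. \<forall>a\<in>verts F. \<kappa> (\<psi> a) = a"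
    and deg: "\<forall>u\<in>verts G. \<epsilon> * real (card (verts G)) ^ (r - 1) \<le> real (card {\<psi> \<in> \<C>. u \<in> \<psi> ` verts F})"
    using far unfolding uniformly_far_from_free_def by (elim exE conjE)
  have finC: "finite \<C>" using C(1) finite_embs[OF fin(2,1)] by (rule finite_subset)
  have cardC: "card {u \<in> verts G. u \<in> \<psi> ` verts F} = card (verts F)" if "\<psi> \<in> \<C>" for \<psi>
  proof -
    have "\<psi> \<in> embs F G" using C(1) that by (rule subsetD)
    then have "{u \<in> verts G. u \<in> \<psi> ` verts F} = \<psi> ` verts F" "inj_on \<psi> (verts F)"
      by (auto simp: embs_def homs_def PiE_iff)
    then show ?thesis by (simp add: card_image)
  qed
  have "\<epsilon> * real (card (verts G)) ^ r = real (card (verts G)) * (\<epsilon> * real (card (verts G)) ^ (r - 1))"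
    using r by (cases r) auto
  also have "\<dots> = (\<Sum>u\<in>verts G. \<epsilon> * real (card (verts G)) ^ (r - 1))" by simp
  also have "\<dots> \<le> (\<Sum>u\<in>verts G. real (card {\<psi> \<in> \<C>. u \<in> \<psi> ` verts F}))"
    using deg by (intro sum_mono) (rule bspec)
  also have "\<dots> = real (\<Sum>u\<in>verts G. card {\<psi> \<in> \<C>. u \<in> \<psi> ` verts F})" by simp
  also have "(\<Sum>u\<in>verts G. card {\<psi> \<in> \<C>. u \<in> \<psi> ` verts F}) = (\<Sum>\<psi>\<in>\<C>. card (verts F))"
    by (rule sum_multicount_gen) (use fin finC cardC in auto)
  finally have "\<epsilon> * real (card (verts G)) ^ r \<le> real (card \<C>) * real (card (verts F))" by simp
  moreover have "partite_packing F G \<kappa> \<C>" using C by (simp add: partite_packing_def packing_def)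
  ultimately show ?thesis by (intro exI conjI)
qed

text \<open>
  For large \<open>n\<close> the \<open>O(n\<^bsup>v(H)-1\<^esup>)\<close> non-injective maps are negligible, so few embeddings means few
  homomorphisms. The constant \<open>c\<close> for which abundance is refuted compensates both this factor \<open>2\<close>
  and the rescaling \<open>x = \<epsilon> / v(F)\<close>. The rescaling comes from \<open>uniformly_far_imp_partite_packing\<close> and
  keeps \<open>x\<close> away from \<open>1\<close>, as is needed to compare powers of \<open>x\<close> later.
\<close>

lemma not_abundant_col_imp_sparse_hosts:
  fixes F :: "'a hypergraph" and H :: "'b hypergraph" and b :: real and B :: nat
  assumes r: "r \<ge> 2" and F: "r_graph r F" "edges F \<noteq> {}" and H: "r_graph r H"
    and not_ab: "\<not> abundant_col r F H \<sigma>" and b: "b > 0" and B: "B > 0"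
  shows "\<exists>x. 0 < x \<and> x \<le> 1 / 2 \<and> has_sparse_hosts r F H x (\<lambda>\<tau>. if \<tau> = \<sigma> then b * x ^ B else 1)"
proof -
  define v where "v = real (card (verts F))"
  define h where "h = card (verts H)"
  define c where "c = b / (2 * v ^ B)"
  have v: "v \<ge> 2" using uniformity_le_card_verts[OF F] r unfolding v_def by linarith
  have c: "c > 0" using b v by (simp add: c_def)
  have "\<not> (\<forall>\<epsilon>. 0 < \<epsilon> \<and> \<epsilon> \<le> 1 \<longrightarrow>
         (\<exists>n\<^sub>0. \<forall>(G :: nat hypergraph) \<kappa>.
            r_graph r G \<and> \<kappa> \<in> homs G F \<and> card (verts G) \<ge> n\<^sub>0 \<and> uniformly_far_from_free r \<epsilon> F G \<kappa> \<longrightarrow>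
            real (Emb_col H \<sigma> G \<kappa>) \<ge> c * \<epsilon> powr (real B) * real (card (verts G)) ^ h))"
    using not_ab c B unfolding abundant_col_def h_def by (metis of_nat_0_less_iff)
  then obtain \<epsilon> where e: "0 < \<epsilon>" "\<epsilon> \<le> 1" and bad: "\<And>n\<^sub>0. \<exists>(G :: nat hypergraph) \<kappa>.
      r_graph r G \<and> \<kappa> \<in> homs G F \<and> card (verts G) \<ge> n\<^sub>0 \<and> uniformly_far_from_free r \<epsilon> F G \<kappa> \<and>
      real (Emb_col H \<sigma> G \<kappa>) < c * \<epsilon> powr (real B) * real (card (verts G)) ^ h"
    by (auto simp: not_le)
  define x where "x = \<epsilon> / v"
  have x: "0 < x" "x \<le> 1 / 2"
    using e v by (auto simp: x_def field_simps)
  have bx: "b * x ^ B = 2 * (c * \<epsilon> ^ B)" using v by (simp add: x_def c_def power_divide)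
  have "has_sparse_hosts r F H x (\<lambda>\<tau>. if \<tau> = \<sigma> then b * x ^ B else 1)"
    unfolding has_sparse_hosts_def
  proof
    fix n0 :: real
    define n1 where "n1 = nat \<lceil>max n0 (real (h ^ 2) / (c * \<epsilon> ^ B))\<rceil> + 1"
    obtain G :: "nat hypergraph" and \<kappa> where G: "r_graph r G" "\<kappa> \<in> homs G F" "card (verts G) \<ge> n1"
      "uniformly_far_from_free r \<epsilon> F G \<kappa>"
      and few: "real (Emb_col H \<sigma> G \<kappa>) < c * \<epsilon> powr (real B) * real (card (verts G)) ^ h"
      using bad[of n1] by (elim exE conjE)
    define n where "n = real (card (verts G))"
    have n1: "max n0 (real (h ^ 2) / (c * \<epsilon> ^ B)) \<le> real n1" unfolding n1_def by linarith
    have nn: "real n1 \<le> n" using G(3) by (simp add: n_def)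
    have n0: "n0 \<le> n" "real (h ^ 2) / (c * \<epsilon> ^ B) \<le> n" using n1 nn by auto
    have "n \<ge> 1" using nn by (simp add: n1_def)
    have fin: "finite (verts G)" "finite (verts H)" using G H by (auto simp: r_graph_def)
    obtain \<C> where C: "partite_packing F G \<kappa> \<C>" "\<epsilon> * n ^ r \<le> real (card \<C>) * v"
      using uniformly_far_imp_partite_packing[OF _ F(1) G(1,4)] r unfolding n_def v_def by auto
    have C': "x * n ^ r \<le> real (card \<C>)" using C(2) v by (simp add: x_def field_simps)
    have all: "card (col_homs H G \<kappa> \<tau>) \<le> card (verts G) ^ h" for \<tau>
    proof -
      have "card (col_homs H G \<kappa> \<tau>) \<le> card (verts H \<rightarrow>\<^sub>E verts G)"
        by (rule card_mono) (use fin in \<open>auto simp: col_homs_def homs_def intro: finite_PiE\<close>)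
      then show ?thesis using fin by (simp add: card_PiE h_def)
    qed
    define Z where "Z = {\<phi> \<in> verts H \<rightarrow>\<^sub>E verts G. \<not> inj_on \<phi> (verts H)}"
    define Y where "Y = {\<phi> \<in> embs H G. \<forall>v\<in>verts H. \<kappa> (\<phi> v) = \<sigma> v}"
    have finZ: "finite Z" 
      by (rule finite_subset[of _ "verts H \<rightarrow>\<^sub>E verts G"])
        (use fin in \<open>auto simp: Z_def intro: finite_PiE\<close>)
    have finY: "finite Y" unfolding Y_def using finite_embs[OF fin(2,1)] by simp
    have "card (col_homs H G \<kappa> \<sigma>) \<le> card (Y \<union> Z)"
      by (rule card_mono) (use finZ finY in \<open>auto simp: Y_def Z_def col_homs_def homs_def embs_def\<close>)
    also have "\<dots> \<le> card Y + card Z" by (rule card_Un_le)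
    finally have split: "real (card (col_homs H G \<kappa> \<sigma>)) \<le> real (card Y) + real (card Z)" by simp
    have "real (card Z * card (verts G)) \<le> real (h ^ 2 * card (verts G) ^ h)"
      unfolding Z_def h_def by (rule of_nat_mono, rule card_non_injective[OF fin(2,1)])
    then have "real (card Z) * n \<le> real (h ^ 2) * n ^ h" by (simp add: n_def)
    also have "\<dots> \<le> (c * \<epsilon> ^ B * n) * n ^ h"
      using n0(2) c e \<open>n \<ge> 1\<close> by (intro mult_right_mono) (auto simp: field_simps)
    finally have "real (card Z) * n \<le> (c * \<epsilon> ^ B * n ^ h) * n" by (simp add: mult_ac)
    then have Zle: "real (card Z) \<le> c * \<epsilon> ^ B * n ^ h" using \<open>n \<ge> 1\<close> by simp
    have Yle: "real (card Y) \<le> c * \<epsilon> ^ B * n ^ h"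
      using few e unfolding Y_def Emb_col_def n_def by (simp add: powr_realpow)
    have "sparse_host r F H x (\<lambda>\<tau>. if \<tau> = \<sigma> then b * x ^ B else 1) G \<kappa> n"
      unfolding sparse_host_def
    proof (intro conjI ballI exI[of _ \<C>] C(1) C' G(1,2))
      show "real (card (verts G)) \<le> n" by (simp add: n_def)
      fix \<tau>
      show "real (card (col_homs H G \<kappa> \<tau>)) \<le> (if \<tau> = \<sigma> then b * x ^ B else 1) * n ^ card (verts H)"
      proof (cases "\<tau> = \<sigma>")
        case True
        have "real (card (col_homs H G \<kappa> \<sigma>)) \<le> 2 * (c * \<epsilon> ^ B) * n ^ h" using split Zle Yle by simp
        then show ?thesis using True by (simp add: bx h_def)
      next
        case False
        then show ?thesis using of_nat_mono[OF all[of \<tau>], where ?'a = real] by (simp add: n_def h_def)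
      qed
    qed
    then show "\<exists>G \<kappa> N. n0 \<le> N \<and> sparse_host r F H x (\<lambda>\<tau>. if \<tau> = \<sigma> then b * x ^ B else 1) G \<kappa> N"
      using n0(1) by (intro exI conjI)
  qed
  then show ?thesis using x by (intro exI conjI)
qed

text \<open>
  For the last \<open>k\<close> with \<open>x\<^sup>k \<ge> \<delta>\<close>, already \<open>x\<^bsup>k+1\<^esup>\<close> is below \<open>\<delta>\<close>, and \<open>2k \<ge> k + 1\<close>.
\<close>

lemma exists_balancing_exponent:
  fixes x \<delta> :: real
  assumes "0 < \<delta>" "\<delta> \<le> x" "x < 1"
  shows "\<exists>k\<ge>1. \<delta> \<le> x ^ k \<and> x ^ (2 * k) \<le> \<delta>"
proof -
  have ex: "\<exists>j. x ^ j < \<delta>" using real_arch_pow_inv[of \<delta> x] assms by auto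
  define j where "j = (LEAST j. x ^ j < \<delta>)"
  have j: "x ^ j < \<delta>" unfolding j_def using ex by (rule LeastI_ex)
  have min: "\<delta> \<le> x ^ i" if "i < j" for i 
    using not_less_Least[of i "\<lambda>j. x ^ j < \<delta>"] that unfolding j_def by (simp add: not_less)
  have "j \<noteq> 0"
  proof
    assume "j = 0"
    then have "1 < \<delta>" using j by simp
    then show False using assms by linarith
  qed
  moreover have "j \<noteq> 1" using j assms by auto
  ultimately have j2: "j \<ge> 2" by linarith
  have "x ^ (2 * (j - 1)) \<le> x ^ j" using assms j2 by (intro power_decreasing) auto
  then show ?thesis using j j2 min[of "j - 1"] by (intro exI[of _ "j - 1"]) auto
qed

lemma colouring_comp:
  assumes H: "r_graph r H" and \<phi>: "\<phi> \<in> homs H G"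
    and \<kappa>: "\<And>x. x \<in> verts G \<Longrightarrow> \<kappa> x \<in> verts F" "\<And>e. e \<in> edges G \<Longrightarrow> \<kappa> ` e \<in> edges F"
  shows "(\<lambda>x\<in>verts H. \<kappa> (\<phi> x)) \<in> homs H F"
proof -
  have "(\<lambda>x\<in>verts H. \<kappa> (\<phi> x)) ` e \<in> edges F" if "e \<in> edges H" for e
  proof -
    have "e \<subseteq> verts H" using H that by (auto simp: r_graph_def)
    then have "(\<lambda>x\<in>verts H. \<kappa> (\<phi> x)) ` e = \<kappa> ` \<phi> ` e" by (force simp: image_image)
    then show ?thesis using \<phi> \<kappa>(2) that by (auto simp: homs_def)
  qed
  moreover have "(\<lambda>x\<in>verts H. \<kappa> (\<phi> x)) \<in> verts H \<rightarrow>\<^sub>E verts F"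
    using \<phi> \<kappa>(1) by (auto simp: homs_def PiE_iff)
  ultimately show ?thesis by (simp add: homs_def)
qed

text \<open>
  Blow up each vertex of \<open>F\<close> to \<open>m\<close> vertices. Of the \<open>m\<^bsup>v(F)\<^esup>\<close> transversal copies of \<open>F\<close>, each edge lies
  in at most \<open>m\<^bsup>v(F)-r\<^esup>\<close>, so destroying all of them takes at least \<open>m\<^sup>r\<close> deletions and the blow-up is
  \<open>v(F)\<^bsup>-r\<^esup>\<close>-far. An embedding of \<open>H\<close> composed with the projection to \<open>F\<close> is then a colouring.
\<close>

lemma abundant_imp_colourable:
  fixes F :: "'a hypergraph" and H :: "'b hypergraph"
  assumes r: "r \<ge> 1" and F: "r_graph r F" "edges F \<noteq> {}" and H: "r_graph r H"
    and ab: "abundant r F H"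
  shows "homs H F \<noteq> {}"
proof -
  define v where "v = card (verts F)"
  have finF: "finite (verts F)" using F by (simp add: r_graph_def)
  have v: "v \<ge> 1" using uniformity_le_card_verts[OF F] r by (simp add: v_def)
  define \<epsilon> where "\<epsilon> = 1 / real v ^ r"
  have "1 \<le> real v ^ r" using v by (simp add: one_le_power)
  then have e: "0 < \<epsilon>" "\<epsilon> \<le> 1" using v by (simp_all add: \<epsilon>_def divide_le_eq)
  obtain c C :: real where c: "c > 0" and lower:
    "\<forall>\<epsilon>. 0 < \<epsilon> \<and> \<epsilon> \<le> 1 \<longrightarrow>
         (\<exists>n\<^sub>0. \<forall>G :: nat hypergraph.
            r_graph r G \<and> card (verts G) \<ge> n\<^sub>0 \<and> far_from_free r \<epsilon> F G \<longrightarrow>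
            real (Emb H G) \<ge> c * \<epsilon> powr C * real (card (verts G)) ^ card (verts H))"
    using ab unfolding abundant_def by (elim exE conjE)
  obtain n0 where n0: "\<forall>G :: nat hypergraph.
            r_graph r G \<and> card (verts G) \<ge> n0 \<and> far_from_free r \<epsilon> F G \<longrightarrow>
            real (Emb H G) \<ge> c * \<epsilon> powr C * real (card (verts G)) ^ card (verts H)"
    using mp[OF spec[OF lower] conjI[OF e]] by (elim exE)
  define m where "m = n0 + 1"
  obtain enc :: "'a \<Rightarrow> nat" where enc: "inj_on enc (verts F)"
    using finite_imp_inj_to_nat_seg[OF finF] by auto
  define P where "P a i = prod_encode (enc a, i)" for a and i :: nat
  define \<kappa> where "\<kappa> z = inv_into (verts F) enc (pfst z)" for z
  have kP: "\<kappa> (P a i) = a" if "a \<in> verts F" for a i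
    using enc that by (simp add: \<kappa>_def P_def)
  have sP: "psnd (P a i) = i" for a i by (simp add: P_def)
  define V where "V = (\<lambda>z. P (fst z) (snd z)) ` (verts F \<times> {..<m})"
  define G where "G = \<lparr>verts = V, edges = {e. e \<subseteq> V \<and> card e = r \<and> \<kappa> ` e \<in> edges F}\<rparr>"
  have injP: "inj_on (\<lambda>z. P (fst z) (snd z)) (verts F \<times> {..<m})"
    by (rule inj_on_inverseI[of _ "\<lambda>z. (\<kappa> z, psnd z)"]) (auto simp: kP sP)
  have cardV: "card V = v * m"
    unfolding V_def card_image[OF injP] by (simp add: card_cartesian_product v_def)
  have finV: "finite V" using finF by (simp add: V_def)
  have G: "r_graph r G" using finV by (auto simp: r_graph_def G_def)
  have kV: "\<kappa> z \<in> verts F" if "z \<in> V" for z using that kP by (auto simp: V_def)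
  have esub: "e \<subseteq> verts F" and ecard: "card e = r" if "e \<in> edges F" for e
    using F that by (auto simp: r_graph_def)
  define \<psi> where "\<psi> f = (\<lambda>a\<in>verts F. P a (f a))" for f :: "'a \<Rightarrow> nat"
  have kpsi: "\<kappa> ` \<psi> f ` e = e" if "e \<in> edges F" for f e
  proof -
    have "\<kappa> (\<psi> f a) = a" if "a \<in> e" for a
      using kP esub[OF \<open>e \<in> edges F\<close>] that by (auto simp: \<psi>_def)
    then show ?thesis by (force simp: image_image)
  qed
  have emb: "\<psi> f \<in> embs F G" if f: "f \<in> verts F \<rightarrow>\<^sub>E {..<m}" for f
  proof -
    have V: "\<psi> f a \<in> V" if "a \<in> verts F" for a
      using f that unfolding V_def \<psi>_def by (intro image_eqI[of _ _ "(a, f a)"]) (auto simp: PiE_iff)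
    have inj: "inj_on (\<psi> f) (verts F)"
      by (rule inj_on_inverseI[of _ \<kappa>]) (simp add: \<psi>_def kP)
    have "\<psi> f ` e \<in> edges G" if e: "e \<in> edges F" for e
      using V esub[OF e] kpsi[OF e, of f] e card_image[OF inj_on_subset[OF inj esub[OF e]]] ecard[OF e]
      by (auto simp: G_def)
    then show ?thesis using V inj by (auto simp: embs_def homs_def G_def \<psi>_def)
  qed
  have far: "far_from_free r \<epsilon> F G"
    unfolding far_from_free_def
  proof (intro allI impI)
    fix D assume D: "D \<subseteq> edges G" and free: "free_of F (delete_edges G D)"
    have finD: "finite D" using D finite_edges[OF G] by (rule finite_subset)
    \<comment> \<open>\<open>X d\<close> consists of the transversal copies that use the edge \<open>d\<close>.\<close>
    define K where "K = verts F \<rightarrow>\<^sub>E {..<m}"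
    define X where "X d = {f \<in> K. \<exists>e\<in>edges F. \<psi> f ` e = d}" for d
    have finK: "finite K" unfolding K_def using finF by (intro finite_PiE) auto
    have cK: "card K = m ^ v" unfolding K_def using finF by (simp add: card_PiE v_def)
    have cover: "K \<subseteq> (\<Union>d\<in>D. X d)"
    proof
      fix f assume f: "f \<in> K"
      have "\<exists>e\<in>edges F. \<psi> f ` e \<in> D"
      proof (rule ccontr)
        assume "\<not> ?thesis"
        then have "\<psi> f \<in> embs F (delete_edges G D)"
          using emb[of f] f unfolding K_def embs_def homs_def delete_edges_def by auto
        then show False using free by (simp add: free_of_def)
      qed
      then show "f \<in> (\<Union>d\<in>D. X d)" using f by (auto simp: X_def)
    qed
    have few: "card (X d) * m ^ r \<le> m ^ v" for d
    proof (cases "X d = {}")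
      case True
      then show ?thesis by simp
    next
      case False
      then obtain f0 e where e: "e \<in> edges F" "\<psi> f0 ` e = d" by (auto simp: X_def)
      have fe: "finite e" using esub[OF e(1)] finF by (rule finite_subset)
      have Xd: "\<psi> f ` e = d" if f: "f \<in> X d" for f
      proof -
        obtain e' where e': "e' \<in> edges F" "\<psi> f ` e' = d" using f by (auto simp: X_def)
        have "e' = e" using kpsi[OF e'(1), of f] kpsi[OF e(1), of f0] e e' by simp
        then show ?thesis using e' by simp
      qed
      have agree: "f a = f' a" if "f \<in> X d" "f' \<in> X d" "a \<in> e" for f f' a
      proof -
        have a: "a \<in> verts F" using esub[OF e(1)] that(3) by auto
        have "\<psi> f a \<in> \<psi> f' ` e" using Xd[OF that(1)] Xd[OF that(2)] that(3) by auto
        then obtain a' where a': "a' \<in> e" "\<psi> f a = \<psi> f' a'" by auto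
        then have "a' \<in> verts F" using esub[OF e(1)] by auto
        then have eq: "P a (f a) = P a' (f' a')" using a' a by (simp add: \<psi>_def)
        have "a = a'" using arg_cong[OF eq, of \<kappa>] kP a \<open>a' \<in> verts F\<close> by simp
        then show ?thesis using arg_cong[OF eq, of psnd] by (simp add: sP)
      qed
      \<comment> \<open>The values on \<open>e\<close> are forced by \<open>d\<close>, so overwriting them loses no information.\<close>
      define g where "g z = (\<lambda>a\<in>verts F. if a \<in> e then snd z a else fst z a)"
        for z :: "('a \<Rightarrow> nat) \<times> ('a \<Rightarrow> nat)"
      have "inj_on g (X d \<times> (e \<rightarrow>\<^sub>E {..<m}))"
      proof (rule inj_onI)
        fix z z' assume z: "z \<in> X d \<times> (e \<rightarrow>\<^sub>E {..<m})" "z' \<in> X d \<times> (e \<rightarrow>\<^sub>E {..<m})" "g z = g z'"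
        have X: "fst z \<in> X d" "fst z' \<in> X d" using z by auto
        have *: "(if a \<in> e then snd z a else fst z a) = (if a \<in> e then snd z' a else fst z' a)"
          if "a \<in> verts F" for a
          using fun_cong[OF z(3), of a] that unfolding g_def by simp
        have "fst z a = fst z' a" if "a \<in> verts F" for a
          using agree[OF X, of a] *[OF that] by (cases "a \<in> e") auto
        then have "fst z = fst z'" using X by (intro PiE_ext[of _ "verts F" "\<lambda>_. {..<m}"]) (auto simp: X_def K_def)
        moreover have "snd z a = snd z' a" if "a \<in> e" for a
          using *[of a] that esub[OF e(1)] by auto
        then have "snd z = snd z'" using z by (intro PiE_ext[of _ e "\<lambda>_. {..<m}"]) auto
        ultimately show "z = z'" by (simp add: prod_eq_iff)
      qed
      moreover have "g ` (X d \<times> (e \<rightarrow>\<^sub>E {..<m})) \<subseteq> K"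
        unfolding g_def X_def K_def by (auto simp: PiE_iff)
      ultimately have "card (X d \<times> (e \<rightarrow>\<^sub>E {..<m})) \<le> card K" using finK by (rule card_inj_on_le)
      then show ?thesis using fe ecard[OF e(1)] by (simp add: card_cartesian_product card_PiE cK)
    qed
    have "card K \<le> card (\<Union>d\<in>D. X d)"
      by (rule card_mono[OF _ cover]) (use finD finK in \<open>auto simp: X_def\<close>)
    also have "\<dots> \<le> (\<Sum>d\<in>D. card (X d))" by (rule card_UN_le[OF finD])
    finally have "m ^ v * m ^ r \<le> (\<Sum>d\<in>D. card (X d)) * m ^ r" unfolding cK by (rule mult_le_mono1)
    also have "\<dots> = (\<Sum>d\<in>D. card (X d) * m ^ r)" by (simp add: sum_distrib_right)
    also have "\<dots> \<le> card D * m ^ v"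
      using sum_mono[of D "\<lambda>d. card (X d) * m ^ r" "\<lambda>_. m ^ v", OF few] by simp
    finally have "m ^ v * m ^ r \<le> m ^ v * card D" by (simp add: mult.commute)
    then have "m ^ r \<le> card D" by (simp add: m_def)
    moreover have "\<epsilon> * real (card (verts G)) ^ r = real (m ^ r)"
      using v by (simp add: G_def cardV \<epsilon>_def power_mult_distrib)
    ultimately show "\<epsilon> * real (card (verts G)) ^ r \<le> real (card D)"
      using of_nat_mono[of "m ^ r" "card D", where ?'a = real] by simp
  qed
  have "m \<le> v * m" using v by simp
  then have size: "n0 \<le> card (verts G)" "0 < card (verts G)" by (auto simp: G_def cardV m_def)
  have "0 < c * \<epsilon> powr C * real (card (verts G)) ^ card (verts H)"
    using c e size by simp
  also have "\<dots> \<le> real (Emb H G)" using n0 G size(1) far by blast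
  finally have "embs H G \<noteq> {}" unfolding Emb_def by auto
  then obtain \<phi> where phi: "\<phi> \<in> homs H G" by (auto simp: embs_def)
  then have "(\<lambda>x\<in>verts H. \<kappa> (\<phi> x)) \<in> homs H F"
    by (rule colouring_comp[OF H]) (use kV in \<open>auto simp: G_def\<close>)
  then show ?thesis by auto
qed

lemma Emb_le_sum_col_homs:
  assumes F: "r_graph r F" and H: "r_graph r H" and G: "r_graph r G" and \<kappa>: "\<kappa> \<in> homs G F"
  shows "Emb H G \<le> (\<Sum>\<sigma>\<in>homs H F. card (col_homs H G \<kappa> \<sigma>))"
proof -
  have fin: "finite (homs H F)" "finite (homs H G)"
    using F G H by (auto simp: r_graph_def intro!: finite_homs)
  have "embs H G \<subseteq> (\<Union>\<sigma>\<in>homs H F. col_homs H G \<kappa> \<sigma>)"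
  proof
    fix \<phi> assume "\<phi> \<in> embs H G"
    then have phi: "\<phi> \<in> homs H G" by (simp add: embs_def)
    define \<sigma> where "\<sigma> = (\<lambda>x\<in>verts H. \<kappa> (\<phi> x))"
    have "\<sigma> \<in> homs H F"
      unfolding \<sigma>_def using phi by (rule colouring_comp[OF H]) (use \<kappa> in \<open>auto simp: homs_def\<close>)
    moreover have "\<phi> \<in> col_homs H G \<kappa> \<sigma>" using phi by (simp add: col_homs_def \<sigma>_def)
    ultimately show "\<phi> \<in> (\<Union>\<sigma>\<in>homs H F. col_homs H G \<kappa> \<sigma>)" by auto
  qed
  then have "Emb H G \<le> card (\<Union>\<sigma>\<in>homs H F. col_homs H G \<kappa> \<sigma>)"
    unfolding Emb_def by (rule card_mono[rotated]) (use fin in \<open>auto simp: col_homs_def\<close>)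
  also have "\<dots> \<le> (\<Sum>\<sigma>\<in>homs H F. card (col_homs H G \<kappa> \<sigma>))" by (rule card_UN_le[OF fin(1)])
  finally show ?thesis .
qed

text \<open>
  The hosts for different \<open>\<sigma>\<close> come with unrelated densities \<open>x\<^sub>\<sigma>\<close>, and a bound \<open>x\<^sub>\<sigma>\<^sup>B\<close> says nothing in
  terms of a much smaller \<open>x\<^sub>\<tau>\<close>. Taking powers first makes all of them comparable with their minimum
  \<open>\<delta>\<close>. This at worst halves the exponent, which is why \<open>2B\<close> is asked of the individual hosts.
\<close>

lemma exists_common_sparse_hosts:
  fixes F :: "'a hypergraph" and H :: "'b hypergraph" and b :: real and B :: nat
  assumes r: "r \<ge> 2" and F: "r_graph r F" "edges F \<noteq> {}" and H: "r_graph r H"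
    and S: "homs H F \<noteq> {}" and not_ab: "\<And>\<sigma>. \<sigma> \<in> homs H F \<Longrightarrow> \<not> abundant_col r F H \<sigma>"
    and b: "0 < b" "b \<le> 1" and B: "B > 0"
  shows "\<exists>\<delta>. 0 < \<delta> \<and> \<delta> \<le> 1 \<and>
           has_sparse_hosts r F H (\<delta> ^ card (homs H F)) (\<lambda>_. b * \<delta> ^ B)"
proof -
  define S where "S = homs H F"
  have S: "finite S" "S \<noteq> {}" using S F H by (auto simp: S_def r_graph_def intro!: finite_homs)
  have "\<forall>\<sigma>\<in>S. \<exists>x. 0 < x \<and> x \<le> 1 / 2 \<and>
      has_sparse_hosts r F H x (\<lambda>\<tau>. if \<tau> = \<sigma> then b * x ^ (2 * B) else 1)"
    using not_abundant_col_imp_sparse_hosts[OF r F H not_ab b(1), of _ "2 * B"] B by (simp add: S_def)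
  then obtain x where x: "\<forall>\<sigma>\<in>S. 0 < x \<sigma> \<and> x \<sigma> \<le> 1 / 2 \<and>
      has_sparse_hosts r F H (x \<sigma>) (\<lambda>\<tau>. if \<tau> = \<sigma> then b * x \<sigma> ^ (2 * B) else 1)"
    by (rule bchoice[THEN exE])
  define \<delta> where "\<delta> = Min (x ` S)"
  have "\<delta> \<in> x ` S" unfolding \<delta>_def using S by (intro Min_in) auto
  then have d: "0 < \<delta>" "\<delta> \<le> 1" using x by auto
  have dle: "\<delta> \<le> x \<sigma>" if "\<sigma> \<in> S" for \<sigma> unfolding \<delta>_def using S that by (intro Min_le) auto
  have balanced: "has_sparse_hosts r F H \<delta> (\<lambda>\<tau>. if \<tau> = \<sigma> then b * \<delta> ^ B else 1)" if s: "\<sigma> \<in> S" for \<sigma>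
  proof -
    have xs: "0 < x \<sigma>" "x \<sigma> < 1" using bspec[OF x s] by auto
    obtain k where k: "k \<ge> 1" "\<delta> \<le> x \<sigma> ^ k" "x \<sigma> ^ (2 * k) \<le> \<delta>"
      using exists_balancing_exponent[OF d(1) dle[OF s] xs(2)] by (elim exE conjE)
    have "has_sparse_hosts r F H (x \<sigma> ^ card {..<k})
        (\<lambda>\<tau>. \<Prod>i\<in>{..<k}. (if \<tau> = \<sigma> then b * x \<sigma> ^ (2 * B) else 1))"
      by (rule has_sparse_hosts_prod[OF F(1) H]) (use x s xs k(1) in \<open>auto simp: lessThan_empty_iff\<close>)
    then show ?thesis
    proof (rule has_sparse_hosts_mono)
      show "\<delta> \<le> x \<sigma> ^ card {..<k}" using k by simp
      fix \<tau>
      have "(b * x \<sigma> ^ (2 * B)) ^ k = b ^ k * (x \<sigma> ^ (2 * k)) ^ B"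
        by (simp add: power_mult_distrib power_mult[symmetric] mult_ac)
      also have "\<dots> \<le> b * \<delta> ^ B"
        using k b xs d power_decreasing[of 1 k b] by (intro mult_mono power_mono) auto
      finally show "(\<Prod>i\<in>{..<k}. (if \<tau> = \<sigma> then b * x \<sigma> ^ (2 * B) else 1))
          \<le> (if \<tau> = \<sigma> then b * \<delta> ^ B else 1)" by simp
    qed
  qed
  have "has_sparse_hosts r F H (\<delta> ^ card S) (\<lambda>\<tau>. \<Prod>\<sigma>\<in>S. (if \<tau> = \<sigma> then b * \<delta> ^ B else 1))"
    by (rule has_sparse_hosts_prod[OF F(1) H _ S balanced]) (use d in auto)
  then have "has_sparse_hosts r F H (\<delta> ^ card S) (\<lambda>_. b * \<delta> ^ B)"
    by (rule has_sparse_hosts_mono) (use S in \<open>auto simp: S_def[symmetric] prod.delta\<close>)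
  then show ?thesis using d unfolding S_def by (intro exI[of _ \<delta>] conjI)
qed

text \<open>
  In the common host, at most \<open>s b \<delta>\<^sup>B N\<^bsup>h\<^esup>\<close> copies of \<open>H\<close> exist, where \<open>s\<close> is the number of colourings
  and \<open>h = v(H)\<close>. Abundance would give at least \<open>c \<delta>\<^bsup>s(C+h)\<^esup> N\<^bsup>h\<^esup>\<close>, the \<open>h\<close> in the exponent accounting
  for \<open>|V(G)| \<ge> \<delta>\<^sup>s N\<close>. So \<open>B \<ge> s(C+h)\<close> and \<open>s b < c\<close> are contradictory.
\<close>

lemma abundant_imp_abundant_col:
  fixes F :: "'a hypergraph" and H :: "'b hypergraph"
  assumes r: "r \<ge> 2" and F: "r_graph r F" "edges F \<noteq> {}" and H: "r_graph r H"
    and ab: "abundant r F H"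
  shows "\<exists>\<sigma>\<in>homs H F. abundant_col r F H \<sigma>"
proof (rule ccontr)
  assume neg: "\<not> ?thesis"
  have r1: "r \<ge> 1" using r by simp
  define S where "S = homs H F"
  define h where "h = card (verts H)"
  define s where "s = card S"
  have Sne: "homs H F \<noteq> {}" by (rule abundant_imp_colourable[OF r1 F H ab])
  have "finite S" using F H by (auto simp: S_def r_graph_def intro!: finite_homs)
  then have s: "s \<ge> 1" using Sne by (simp add: s_def S_def Suc_le_eq card_gt_0_iff)
  obtain c C :: real where c: "c > 0" "C > 0" and lower:
    "\<forall>\<epsilon>. 0 < \<epsilon> \<and> \<epsilon> \<le> 1 \<longrightarrow>
         (\<exists>n\<^sub>0. \<forall>G :: nat hypergraph.
            r_graph r G \<and> card (verts G) \<ge> n\<^sub>0 \<and> far_from_free r \<epsilon> F G \<longrightarrow>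
            real (Emb H G) \<ge> c * \<epsilon> powr C * real (card (verts G)) ^ card (verts H))"
    using ab unfolding abundant_def by (elim exE conjE)
  define B where "B = nat \<lceil>real s * (C + real h)\<rceil> + 1"
  have B: "real s * (C + real h) \<le> real B" "B > 0" unfolding B_def by linarith+
  define b where "b = min 1 (c / (2 * real s))"
  have b: "0 < b" "b \<le> 1" using c s by (auto simp: b_def)
  have "real s * b \<le> real s * (c / (2 * real s))" by (intro mult_left_mono) (auto simp: b_def)
  then have sb: "real s * b < c" using s c by simp
  obtain \<delta> where d: "0 < \<delta>" "\<delta> \<le> 1"
    and hosts: "has_sparse_hosts r F H (\<delta> ^ s) (\<lambda>_. b * \<delta> ^ B)"
    using exists_common_sparse_hosts[OF r F H Sne _ b B(2)] neg unfolding s_def S_def by auto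
  define \<eta> where "\<eta> = \<delta> ^ s"
  have e: "0 < \<eta>" "\<eta> \<le> 1" using d by (auto simp: \<eta>_def power_le_one)
  obtain n0 where n0: "\<forall>G :: nat hypergraph.
            r_graph r G \<and> card (verts G) \<ge> n0 \<and> far_from_free r \<eta> F G \<longrightarrow>
            real (Emb H G) \<ge> c * \<eta> powr C * real (card (verts G)) ^ card (verts H)"
    using mp[OF spec[OF lower] conjI[OF e]] by (elim exE)
  obtain G \<kappa> N where N: "max 1 (real n0 / \<eta>) \<le> N" and host: "sparse_host r F H \<eta> (\<lambda>_. b * \<delta> ^ B) G \<kappa> N"
    using hosts unfolding has_sparse_hosts_def \<eta>_def by meson
  define n where "n = real (card (verts G))"
  have G: "r_graph r G" "\<kappa> \<in> homs G F" "n \<le> N"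
    and few: "\<And>\<sigma>. \<sigma> \<in> homs H F \<Longrightarrow> real (card (col_homs H G \<kappa> \<sigma>)) \<le> b * \<delta> ^ B * N ^ h"
    using host unfolding sparse_host_def n_def h_def by auto
  obtain \<C> where P: "packing F G \<C>" and big: "\<eta> * N ^ r \<le> real (card \<C>)"
    using host unfolding sparse_host_def partite_packing_def by auto
  have finV: "finite (verts G)" using G by (simp add: r_graph_def)
  have "real (card \<C>) \<le> n ^ r"
    using of_nat_mono[OF card_packing_le[OF F finV P], where ?'a = real] by (simp add: n_def)
  then have "\<eta> * N ^ r \<le> n ^ r" using big by simp
  then have size: "\<eta> * N \<le> n"
    by (rule mult_le_of_mult_power_le[rotated -1]) (use e r N in \<open>auto simp: n_def\<close>)
  have "real n0 \<le> \<eta> * N" using N e by (simp add: field_simps)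
  then have n: "n0 \<le> card (verts G)" using size by (simp add: n_def)
  have far: "far_from_free r \<eta> F G"
    unfolding far_from_free_def
  proof (intro allI impI)
    fix D assume D: "D \<subseteq> edges G" "free_of F (delete_edges G D)"
    have "finite D" using D(1) finite_edges[OF G(1)] by (rule finite_subset)
    then have "real (card \<C>) \<le> real (card D)"
      using card_packing_le_card_deletion[OF P _ D(2)] by simp
    moreover have "\<eta> * n ^ r \<le> \<eta> * N ^ r" using e G(3) by (simp add: n_def power_mono)
    ultimately show "\<eta> * real (card (verts G)) ^ r \<le> real (card D)" using big by (simp add: n_def)
  qed
  have "c * \<delta> ^ B * N ^ h \<le> c * \<eta> powr C * (\<eta> * N) ^ h"
  proof -
    have "\<delta> ^ B = \<delta> powr real B" using d by (simp add: powr_realpow)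
    also have "\<dots> \<le> \<delta> powr (real s * (C + real h))" using d B by (intro powr_mono') auto
    also have "\<dots> = \<eta> powr (C + real h)" using d by (simp add: \<eta>_def powr_realpow[symmetric] powr_powr)
    also have "\<dots> = \<eta> powr C * \<eta> ^ h" using e by (simp add: powr_add powr_realpow)
    finally have "\<delta> ^ B \<le> \<eta> powr C * \<eta> ^ h" .
    then have "(c * N ^ h) * \<delta> ^ B \<le> (c * N ^ h) * (\<eta> powr C * \<eta> ^ h)"
      using c N by (intro mult_left_mono) auto
    then show ?thesis by (simp add: power_mult_distrib mult_ac)
  qed
  also have "\<dots> \<le> c * \<eta> powr C * n ^ h"
    using size c e N by (intro mult_left_mono power_mono) auto
  also have "\<dots> \<le> real (Emb H G)" using n0 G(1) n far unfolding n_def h_def by blast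
  also have "\<dots> \<le> real (\<Sum>\<sigma>\<in>homs H F. card (col_homs H G \<kappa> \<sigma>))"
    by (rule of_nat_mono, rule Emb_le_sum_col_homs[OF F(1) H G(1,2)])
  also have "\<dots> \<le> real s * (b * \<delta> ^ B * N ^ h)"
    using sum_mono[of "homs H F" "\<lambda>\<sigma>. real (card (col_homs H G \<kappa> \<sigma>))" "\<lambda>_. b * \<delta> ^ B * N ^ h", OF few]
    by (simp add: s_def S_def)
  also have "\<dots> = (real s * b) * (\<delta> ^ B * N ^ h)" by simp
  also have "\<dots> < c * (\<delta> ^ B * N ^ h)" using sb d N by (intro mult_strict_right_mono) auto
  finally show False by (simp add: mult.assoc)
qed

theorem corollary1p6:
  fixes r :: nat and F :: "'a hypergraph" and H :: "'b hypergraph"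
  assumes "r \<ge> 2"
    and "r_graph r F" and "edges F \<noteq> {}"
    and "r_graph r H"
  shows "abundant r F H \<longleftrightarrow> (\<exists>\<sigma> \<in> homs H F. abundant_col r F H \<sigma>)"
proof
  assume "abundant r F H"
  then show "\<exists>\<sigma> \<in> homs H F. abundant_col r F H \<sigma>" by (rule abundant_imp_abundant_col[OF assms])
next
  assume "\<exists>\<sigma> \<in> homs H F. abundant_col r F H \<sigma>"
  then obtain \<sigma> where ab: "abundant_col r F H \<sigma>" by (elim bexE)
  have "r \<ge> 1" using assms(1) by simp
  then show "abundant r F H" by (rule abundant_if_abundant_col[OF _ assms(2-4) ab])
qed

end
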